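(* Let $0\le\alpha\le\frac14$, and let $c>0$ and the integer $n\ge0$ be such that $0<q<\frac{3}{17}$, where $q=\frac{c^2}{\chi_n^\alpha(c)}$. Then $$n(n+2\alpha+1)+C_\alpha c^2\le\chi_n^\alpha(c)\le n(n+2\alpha+1)+c^2,$$ where $C_\alpha=2(2\alpha+1)^2+1-2(2\alpha+1)\sqrt{1+(2\alpha+1)^2}$.
   Context: Let $\omega_\alpha(x)=(1-x^2)^\alpha$ on $I=[-1,1]$. For $c>0$, consider the Sturm-Liouville operator $\mathcal L_c^{(\alpha)}f(x)=-\frac{1}{\omega_\alpha(x)}\frac{d}{dx}\left[\omega_\alpha(x)(1-x^2)f'(x)\right]+c^2x^2f(x)$ acting in $L^2(I,\omega_\alpha)$, with eigenfunctions required to be bounded on $I$. Its eigenvalues are listed in increasing order as $\chi_0^\alpha(c)<\chi_1^\alpha(c)<\cdots$, so that $\chi_n^\alpha(c)$ is the $(n+1)$-th eigenvalue. *)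

theory Defs
  imports "HOL-Analysis.Analysis"
begin

definition weight :: "real \<Rightarrow> real \<Rightarrow> real" where
  "weight \<alpha> x = (1 - x\<^sup>2) powr \<alpha>"

definition SL_op :: "real \<Rightarrow> real \<Rightarrow> (real \<Rightarrow> real) \<Rightarrow> real \<Rightarrow> real" where
  "SL_op \<alpha> c f x =
     - (1 / weight \<alpha> x) * deriv (\<lambda>t. weight \<alpha> t * (1 - t\<^sup>2) * deriv f t) x + c\<^sup>2 * x\<^sup>2 * f x"

text \<open>
  An eigenfunction is a classical solution on the open interval, where the operator is regular;
  it lies in the weighted \<open>L\<^sup>2\<close> space, is bounded, and does not vanish identically
  on the open interval (values at the two endpoints alone carry no information).
\<close>

definition SL_eigenfunction :: "real \<Rightarrow> real \<Rightarrow> real \<Rightarrow> (real \<Rightarrow> real) \<Rightarrow> bool" where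
  "SL_eigenfunction \<alpha> c l f \<longleftrightarrow>
     (\<forall>x\<in>{-1<..<1}. f differentiable at x) \<and>
     (\<forall>x\<in>{-1<..<1}. (\<lambda>t. weight \<alpha> t * (1 - t\<^sup>2) * deriv f t) differentiable at x) \<and>
     set_integrable lborel {-1..1} (\<lambda>x. (f x)\<^sup>2 * weight \<alpha> x) \<and>
     bounded (f ` {-1..1}) \<and>
     (\<exists>x\<in>{-1<..<1}. f x \<noteq> 0) \<and>
     (\<forall>x\<in>{-1<..<1}. SL_op \<alpha> c f x = l * f x)"

definition SL_eigenvalues :: "real \<Rightarrow> real \<Rightarrow> real set" where
  "SL_eigenvalues \<alpha> c = {l. \<exists>f. SL_eigenfunction \<alpha> c l f}"

text \<open>
  The eigenvalue at position \<open>n\<close>, counted from \<open>0\<close>, of the increasing list of eigenvalues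
  is the one with exactly \<open>n\<close> eigenvalues strictly below it. Finiteness is
  required separately because the cardinality of an infinite set is \<open>0\<close>.
\<close>

definition chi :: "real \<Rightarrow> real \<Rightarrow> nat \<Rightarrow> real" where
  "chi \<alpha> c n = (THE l. l \<in> SL_eigenvalues \<alpha> c \<and>
     finite {m \<in> SL_eigenvalues \<alpha> c. m < l} \<and> card {m \<in> SL_eigenvalues \<alpha> c. m < l} = n)"

lemma chi_eqI:
  assumes "l \<in> SL_eigenvalues \<alpha> c" "finite {m \<in> SL_eigenvalues \<alpha> c. m < l}"
    and "card {m \<in> SL_eigenvalues \<alpha> c. m < l} = n"
  shows "chi \<alpha> c n = l"
proof -
  let ?B = "\<lambda>l. {m \<in> SL_eigenvalues \<alpha> c. m < l}"
  have less: "card (?B a) < card (?B b)"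
    if "a \<in> SL_eigenvalues \<alpha> c" "finite (?B b)" "a < b" for a b
    by (rule psubset_card_mono) (use that in auto)
  show ?thesis
    unfolding chi_def
  proof (rule the_equality)
    fix k
    assume k: "k \<in> SL_eigenvalues \<alpha> c \<and> finite (?B k) \<and> card (?B k) = n"
    show "k = l"
      using less[of k l] less[of l k] k assms by (cases k l rule: linorder_cases) auto
  qed (use assms in auto)
qed

definition C_const :: "real \<Rightarrow> real" where
  "C_const \<alpha> = 2 * (2 * \<alpha> + 1)\<^sup>2 + 1 - 2 * (2 * \<alpha> + 1) * sqrt (1 + (2 * \<alpha> + 1)\<^sup>2)"

end

theory Submission imports Defs "HOL-Real_Asymp.Real_Asymp" begin

text \<open>
  Write the equation as \<open>(p f')' = - q f\<close> on \<open>(-1, 1)\<close> with \<open>p = (1 - x\<^sup>2) \<omega>\<close> and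
  \<open>q = (l - c\<^sup>2 x\<^sup>2) \<omega>\<close>, where \<open>\<omega>\<close> is the weight. Everything rests on Sturm-Picone comparison
  (\<open>sturm_comparison\<close>): enlarging \<open>q\<close> and shrinking \<open>p\<close> increases the number of zeros, also when
  the intervals between zeros end at the singular points \<open>-1\<close> and \<open>1\<close>.

  The position of an eigenvalue in the list is the number of zeros of its eigenfunction. For every
  \<open>l\<close> the Frobenius series at \<open>1\<close> gives the solution \<open>reg\<close> that is bounded there. By the symmetry
  \<open>x \<mapsto> -x\<close>, \<open>l\<close> is an eigenvalue exactly if \<open>reg\<close> is even or odd (\<open>eigenvalue_iff\<close>). A Pruefer
  angle of \<open>reg\<close> at \<open>0\<close> depends continuously on \<open>l\<close>, counts the zeros in \<open>(0, 1)\<close>, and runs from a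
  nonpositive value to arbitrarily large ones, so the intermediate value theorem produces an
  eigenvalue with exactly \<open>n\<close> zeros for each \<open>n\<close> (\<open>eigenvalue_with_nodes\<close>). By comparison the
  number of zeros increases strictly with the eigenvalue, hence \<open>chi \<alpha> c n\<close> is the eigenvalue with
  \<open>n\<close> zeros (\<open>chi_nodes\<close>). For \<open>c = 0\<close> and \<open>l = n (n + 2 \<alpha> + 1)\<close> the series terminates and is the
  Gegenbauer polynomial of degree \<open>n\<close>, which has \<open>n\<close> zeros.

  Both estimates compare this polynomial with the eigenfunction of \<open>\<chi> = chi \<alpha> c n\<close>; put
  \<open>\<lambda> = n (n + 2 \<alpha> + 1)\<close>. If \<open>\<chi> > \<lambda> + c\<^sup>2\<close>, then \<open>\<chi> - c\<^sup>2 x\<^sup>2 > \<lambda>\<close> throughout and the eigenfunction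
  would have more than \<open>n\<close> zeros (\<open>chi_upper_bound\<close>). For the lower estimate let \<open>C = C_const \<alpha>\<close>.
  The assumption \<open>\<chi> < \<lambda> + C c\<^sup>2\<close> does not give a pointwise inequality, because \<open>C - x\<^sup>2\<close> changes
  sign. The polynomial, \<open>P\<close>, is therefore replaced by \<open>P \<circ> h\<close>
  with \<open>h x = x + 2 e x (1 - x\<^sup>2)\<close> and \<open>e = c\<^sup>2 / (10 \<lambda>)\<close>. The odd cubic \<open>h\<close> maps \<open>[-1, 1]\<close> onto
  itself and speeds \<open>P\<close> up near \<open>0\<close>, where \<open>C - x\<^sup>2\<close> is positive, at the expense of the ends. The
  function \<open>P \<circ> h\<close> has at most as many zeros as \<open>P\<close> and solves an equation with
  coefficients \<open>p(h) / h'\<close> and \<open>\<lambda> \<omega>(h) h'\<close> (\<open>nodes_less_transplanted\<close>). If \<open>e\<close> is small, then the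
  first of them is at most the \<open>p\<close> and the second exceeds the \<open>q\<close> of the eigenfunction, which
  would have fewer than \<open>n\<close> zeros (\<open>chi_lower_bound\<close>). Smallness of \<open>e\<close> is what the bound \<open>3 / 17\<close>
  on \<open>c\<^sup>2 / \<chi>\<close> provides.
\<close>

section \<open>Sturm-Picone comparison and uniqueness\<close>

text \<open>
  The derivative is carried as a separate function, so that \<open>p f'\<close> is differentiated as a whole;
  \<open>p\<close> itself may lack a derivative, as it does in \<open>nodes_less_transplanted\<close>.
\<close>

definition SL_solution ::
  "(real \<Rightarrow> real) \<Rightarrow> (real \<Rightarrow> real) \<Rightarrow> (real \<Rightarrow> real) \<Rightarrow> (real \<Rightarrow> real) \<Rightarrow> bool" where
  "SL_solution p q f f' \<longleftrightarrow>
     (\<forall>x\<in>{-1<..<1}. (f has_real_derivative f' x) (at x) \<and>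
        ((\<lambda>t. p t * f' t) has_real_derivative - q x * f x) (at x))"

text \<open>
  Satisfied by the nontrivial bounded solutions at a singular end, and violated by the unbounded
  ones, for which \<open>p f'\<close> has a nonzero limit.
\<close>

definition regular_end ::
  "(real \<Rightarrow> real) \<Rightarrow> (real \<Rightarrow> real) \<Rightarrow> (real \<Rightarrow> real) \<Rightarrow> real filter \<Rightarrow> bool" where
  "regular_end p f f' F \<longleftrightarrow> (\<exists>A. A \<noteq> 0 \<and> (f \<longlongrightarrow> A) F) \<and> ((\<lambda>x. p x * f' x) \<longlongrightarrow> 0) F"

definition nodes :: "(real \<Rightarrow> real) \<Rightarrow> real set" where
  "nodes f = {x \<in> {-1<..<1}. f x = 0}"

definition picone ::
  "(real \<Rightarrow> real) \<Rightarrow> (real \<Rightarrow> real) \<Rightarrow> (real \<Rightarrow> real) \<Rightarrow>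
   (real \<Rightarrow> real) \<Rightarrow> (real \<Rightarrow> real) \<Rightarrow> (real \<Rightarrow> real) \<Rightarrow> real \<Rightarrow> real" where
  "picone p u u' r v v' x = u x * (p x * u' x) - (u x)\<^sup>2 / v x * (r x * v' x)"

lemma SL_solutionD:
  assumes "SL_solution p q f f'" "-1 < x" "x < 1"
  shows "(f has_real_derivative f' x) (at x)"
    and "((\<lambda>t. p t * f' t) has_real_derivative - q x * f x) (at x)"
    and "isCont f x" and "isCont (\<lambda>t. p t * f' t) x"
  using assms unfolding SL_solution_def by (auto intro: DERIV_isCont)

text \<open>
  Picone's identity: with \<open>(p u')' = - q u\<close> and \<open>(r v')' = - s v\<close> the derivative equals
  \<open>(s - q) u\<^sup>2 + (p - r) u'\<^sup>2 + r (u' - u v' / v)\<^sup>2\<close>.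
\<close>

lemma picone_deriv_pos:
  assumes "(u has_real_derivative u' x) (at x)" "(v has_real_derivative v' x) (at x)"
    and "((\<lambda>t. p t * u' t) has_real_derivative - q x * u x) (at x)"
    and "((\<lambda>t. r t * v' t) has_real_derivative - s x * v x) (at x)"
    and "u x \<noteq> 0" "v x \<noteq> 0" "0 < r x" "r x \<le> p x" "q x < s x"
  shows "\<exists>D>0. (picone p u u' r v v' has_real_derivative D) (at x)"
proof -
  define D where "D = u' x * (p x * u' x) + u x * (- q x * u x)
    - ((2 * u x * u' x * v x - (u x)\<^sup>2 * v' x) / (v x)\<^sup>2 * (r x * v' x) + (u x)\<^sup>2 / v x * (- s x * v x))"
  have product: "((\<lambda>x. u x * U x - (u x)\<^sup>2 / v x * V x) has_real_derivative
      u' x * U x + u x * dU - ((2 * u x * u' x * v x - (u x)\<^sup>2 * v' x) / (v x)\<^sup>2 * V x + (u x)\<^sup>2 / v x * dV)) (at x)"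
    if "(U has_real_derivative dU) (at x)" "(V has_real_derivative dV) (at x)" for U V dU dV
    using assms(6)
    by (auto intro!: derivative_eq_intros assms(1,2) that simp: power2_eq_square field_simps)
  have "((\<lambda>x. u x * (p x * u' x) - (u x)\<^sup>2 / v x * (r x * v' x)) has_real_derivative D) (at x)"
    using product[OF assms(3,4)] by (simp add: D_def)
  moreover have "D = (s x - q x) * (u x)\<^sup>2 + (p x - r x) * (u' x)\<^sup>2
      + r x * (u' x - u x * v' x / v x)\<^sup>2"
    unfolding D_def using assms(6) by (simp add: field_simps power2_eq_square)
  moreover have "0 < (s x - q x) * (u x)\<^sup>2"
    using assms by simp
  moreover have "0 \<le> (p x - r x) * (u' x)\<^sup>2" "0 \<le> r x * (u' x - u x * v' x / v x)\<^sup>2"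
    using assms by simp_all
  ultimately show ?thesis
    unfolding picone_def by (intro exI[of _ D]) (auto simp: picone_def[abs_def])
qed

text \<open>
  If \<open>v\<close> had no zero, the Picone function would be strictly increasing while tending to \<open>0\<close> at
  both ends.
\<close>

lemma picone_zero_between:
  fixes a b :: real
  assumes "a < b" "-1 \<le> a" "b \<le> 1"
    and u: "SL_solution p q u u'" and v: "SL_solution r s v v'"
    and coeff: "\<And>x. a < x \<Longrightarrow> x < b \<Longrightarrow> 0 < r x \<and> r x \<le> p x \<and> q x < s x"
    and u0: "\<And>x. a < x \<Longrightarrow> x < b \<Longrightarrow> u x \<noteq> 0"
    and lim_a: "(picone p u u' r v v' \<longlongrightarrow> 0) (at_right a)"
    and lim_b: "(picone p u u' r v v' \<longlongrightarrow> 0) (at_left b)"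
  shows "\<exists>x. a < x \<and> x < b \<and> v x = 0"
proof (rule ccontr)
  let ?\<Phi> = "picone p u u' r v v'"
  assume "\<not> ?thesis"
  then have v0: "v x \<noteq> 0" if "a < x" "x < b" for x
    using that by blast
  have deriv: "\<exists>D>0. (?\<Phi> has_real_derivative D) (at x)" if "a < x" "x < b" for x
  proof -
    have x: "-1 < x" "x < 1" using that assms(2,3) by simp_all
    show ?thesis
      using coeff[OF that] u0[OF that] v0[OF that]
      by (intro picone_deriv_pos[where u = u and u' = u' and v = v and v' = v' and p = p
            and r = r and q = q and s = s] SL_solutionD[OF u x] SL_solutionD[OF v x]) simp_all
  qed
  have less: "?\<Phi> x < ?\<Phi> y" if "a < x" "x < y" "y < b" for x y
  proof (rule DERIV_pos_imp_increasing[OF that(2)])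
    fix t assume "x \<le> t" "t \<le> y"
    then have "a < t" "t < b" using that by simp_all
    then show "\<exists>D. (?\<Phi> has_real_derivative D) (at t) \<and> 0 < D"
      using deriv by blast
  qed
  obtain x where x: "a < x" "x < b"
    using dense[OF \<open>a < b\<close>] by blast
  obtain y where y: "x < y" "y < b"
    using dense[OF x(2)] by blast
  have "eventually (\<lambda>t. t \<in> {a<..<x}) (at_right a)"
    using x(1) eventually_at_right_real by blast
  then have "0 \<le> ?\<Phi> x"
    using x y by (intro tendsto_upperbound[OF lim_a])
      (auto elim!: eventually_mono intro!: less_imp_le[OF less])
  moreover have "eventually (\<lambda>t. t \<in> {y<..<b}) (at_left b)"
    using y(2) eventually_at_left_real by blast
  then have "?\<Phi> y \<le> 0"
    using x y by (intro tendsto_lowerbound[OF lim_b])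
      (auto elim!: eventually_mono intro!: less_imp_le[OF less])
  ultimately show False
    using less[of x y] x y by simp
qed

text \<open>
  If \<open>v\<close> vanishes together with \<open>u\<close>, simplicity of the zero of \<open>v\<close> keeps \<open>u / v\<close> bounded.
\<close>

lemma picone_tendsto_interior:
  assumes u: "SL_solution p q u u'" and v: "SL_solution r s v v'"
    and a: "-1 < a" "a < 1" "u a = 0" and simple: "v a = 0 \<Longrightarrow> v' a \<noteq> 0"
  shows "(picone p u u' r v v' \<longlongrightarrow> 0) (at a)"
proof -
  note U = SL_solutionD[OF u a(1,2)] and V = SL_solutionD[OF v a(1,2)]
  have uv: "\<exists>L. ((\<lambda>x. u x / v x) \<longlongrightarrow> L) (at a)"
  proof (cases "v a = 0")
    case False
    then show ?thesis
      using U(3) V(3) by (intro exI[of _ "u a / v a"]) (auto simp: isCont_def intro: tendsto_divide)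
  next
    case True
    have "((\<lambda>x. (u x / (x - a)) / (v x / (x - a))) \<longlongrightarrow> u' a / v' a) (at a)"
      using U(1) V(1) a(3) True simple
      by (intro tendsto_divide) (auto simp: has_field_derivative_iff)
    moreover have "eventually (\<lambda>x. (u x / (x - a)) / (v x / (x - a)) = u x / v x) (at a)"
      by (auto simp: eventually_at_filter)
    ultimately have "((\<lambda>x. u x / v x) \<longlongrightarrow> u' a / v' a) (at a)"
      by (rule Lim_transform_eventually)
    then show ?thesis by blast
  qed
  then obtain L where L: "((\<lambda>x. u x / v x) \<longlongrightarrow> L) (at a)" by blast
  have "((\<lambda>x. u x * (p x * u' x) - u x * (u x / v x) * (r x * v' x)) \<longlongrightarrow>
      u a * (p a * u' a) - u a * L * (r a * v' a)) (at a)"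
    by (rule tendsto_diff[OF tendsto_mult[OF U(3,4)[unfolded isCont_def]]
          tendsto_mult[OF tendsto_mult[OF U(3)[unfolded isCont_def] L] V(4)[unfolded isCont_def]]])
  then show ?thesis
    using a(3) by (simp add: picone_def[abs_def] power2_eq_square)
qed

lemma picone_tendsto_regular:
  assumes "regular_end p u u' F" "regular_end r v v' F"
  shows "(picone p u u' r v v' \<longlongrightarrow> 0) F"
proof -
  obtain A B where "(u \<longlongrightarrow> A) F" "(v \<longlongrightarrow> B) F" "B \<noteq> 0"
    "((\<lambda>x. p x * u' x) \<longlongrightarrow> 0) F" "((\<lambda>x. r x * v' x) \<longlongrightarrow> 0) F"
    using assms unfolding regular_end_def by blast
  then have "((\<lambda>x. u x * (p x * u' x) - (u x)\<^sup>2 / v x * (r x * v' x)) \<longlongrightarrow> A * 0 - A\<^sup>2 / B * 0) F"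
    by (intro tendsto_diff tendsto_mult tendsto_divide tendsto_power)
  then show ?thesis
    by (simp add: picone_def[abs_def])
qed

text \<open>
  The zeros of \<open>u\<close> cut \<open>(-1, 1)\<close> into one more interval than there are zeros, and \<open>v\<close> has a zero
  inside each of them.
\<close>

lemma sturm_comparison:
  assumes u: "SL_solution p q u u'" and v: "SL_solution r s v v'"
    and coeff: "\<And>x. -1 < x \<Longrightarrow> x < 1 \<Longrightarrow> 0 < r x \<and> r x \<le> p x \<and> q x < s x"
    and ends: "regular_end p u u' (at_left 1)" "regular_end p u u' (at_right (-1))"
      "regular_end r v v' (at_left 1)" "regular_end r v v' (at_right (-1))"
    and simple: "\<And>x. -1 < x \<Longrightarrow> x < 1 \<Longrightarrow> v x = 0 \<Longrightarrow> v' x \<noteq> 0"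
    and fin: "finite (nodes u)" "finite (nodes v)"
  shows "card (nodes u) < card (nodes v)"
proof -
  \<comment> \<open>The right end of the interval that starts at \<open>z\<close>.\<close>
  define nxt where "nxt z = Min {y \<in> insert 1 (nodes u). z < y}" for z
  have nxt: "nxt z \<in> insert 1 (nodes u)" "z < nxt z"
    "\<And>y. y \<in> insert 1 (nodes u) \<Longrightarrow> z < y \<Longrightarrow> nxt z \<le> y" if "z < 1" for z
  proof -
    let ?S = "{y \<in> insert 1 (nodes u). z < y}"
    have S: "finite ?S" "1 \<in> ?S" using fin that by auto
    have "nxt z \<in> ?S"
      unfolding nxt_def using S by (intro Min_in) blast+
    then show "nxt z \<in> insert 1 (nodes u)" "z < nxt z" by simp_all
    show "nxt z \<le> y" if "y \<in> insert 1 (nodes u)" "z < y" for y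
      unfolding nxt_def using S(1) that by (intro Min_le) simp_all
  qed
  have "\<exists>x. z < x \<and> x < nxt z \<and> v x = 0" if z: "z \<in> insert (-1) (nodes u)" for z
  proof -
    have z1: "-1 \<le> z" "z < 1" using z by (auto simp: nodes_def)
    have n1: "nxt z \<le> 1" using nxt(1)[OF z1(2)] by (auto simp: nodes_def)
    show ?thesis
    proof (rule picone_zero_between[OF _ _ _ u v])
      show "u x \<noteq> 0" if "z < x" "x < nxt z" for x
        using nxt(3)[OF z1(2), of x] that z1 n1 by (auto simp: nodes_def)
      show "(picone p u u' r v v' \<longlongrightarrow> 0) (at_right z)"
      proof (cases "z = -1")
        case True
        then show ?thesis using picone_tendsto_regular ends by metis
      next
        case False
        then have "(picone p u u' r v v' \<longlongrightarrow> 0) (at z)"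
          using z z1 simple by (intro picone_tendsto_interior[OF u v]) (auto simp: nodes_def)
        then show ?thesis by (rule tendsto_within_subset) auto
      qed
      show "(picone p u u' r v v' \<longlongrightarrow> 0) (at_left (nxt z))"
      proof (cases "nxt z = 1")
        case True
        then show ?thesis using picone_tendsto_regular ends by metis
      next
        case False
        then have "(picone p u u' r v v' \<longlongrightarrow> 0) (at (nxt z))"
          using nxt(1,2)[OF z1(2)] z1 simple
          by (intro picone_tendsto_interior[OF u v]) (auto simp: nodes_def)
        then show ?thesis by (rule tendsto_within_subset) auto
      qed
    qed (use z1 n1 nxt(2)[OF z1(2)] coeff in auto)
  qed
  then obtain g where g: "z < g z" "g z < nxt z" "v (g z) = 0"
    if "z \<in> insert (-1) (nodes u)" for z
    by metis
  have z1: "-1 \<le> z" "z < 1" if "z \<in> insert (-1) (nodes u)" for z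
    using that by (auto simp: nodes_def)
  have mono: "g z < g w" if "z \<in> insert (-1) (nodes u)" "w \<in> insert (-1) (nodes u)" "z < w" for z w
    using nxt(3)[of z w] g(2)[OF that(1)] g(1)[OF that(2)] that z1[OF that(1)] by auto
  have "inj_on g (insert (-1) (nodes u))"
    by (rule linorder_inj_onI') (metis mono order_less_irrefl)
  moreover have "g ` insert (-1) (nodes u) \<subseteq> nodes v"
  proof
    fix y assume "y \<in> g ` insert (-1) (nodes u)"
    then obtain z where z: "z \<in> insert (-1) (nodes u)" and y: "y = g z" by blast
    have "nxt z \<le> 1" using nxt(1)[of z] z1[OF z] by (auto simp: nodes_def)
    then show "y \<in> nodes v" using g[OF z] z1[OF z] y by (auto simp: nodes_def)
  qed
  ultimately have "card (insert (-1) (nodes u)) \<le> card (nodes v)"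
    using fin(2) card_inj_on_le by blast
  moreover have "-1 \<notin> nodes u" by (auto simp: nodes_def)
  ultimately show ?thesis using fin(1) by simp
qed

text \<open>
  Gronwall's argument: \<open>E = f\<^sup>2 + (p f')\<^sup>2\<close> satisfies \<open>\<bar>E'\<bar> \<le> K E\<close> on compact subintervals, so \<open>E\<close>
  vanishes identically once it vanishes at a point.
\<close>

lemma SL_solution_unique:
  assumes f: "SL_solution p q f f'"
    and cont: "continuous_on {-1<..<1} p" "continuous_on {-1<..<1} q"
    and pos: "\<And>x. -1 < x \<Longrightarrow> x < 1 \<Longrightarrow> 0 < p x"
    and init: "f x0 = 0" "f' x0 = 0" and x0: "-1 < x0" "x0 < 1" and x: "-1 < x" "x < 1"
  shows "f x = 0"
proof -
  define a where "a = min x x0"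
  define b where "b = max x x0"
  have ab: "-1 < a" "a \<le> b" "b < 1" "a \<le> x" "x \<le> b" "a \<le> x0" "x0 \<le> b"
    using x0 x by (auto simp: a_def b_def)
  define F where "F y = p y * f' y" for y
  define E where "E y = (f y)\<^sup>2 + (F y)\<^sup>2" for y
  define k where "k y = 1 / p y - q y" for y
  have sub: "{a..b} \<subseteq> {-1<..<1}" using ab by auto
  have p0: "p y \<noteq> 0" if "y \<in> {a..b}" for y
    using pos[of y] that ab by simp
  have "continuous_on {a..b} k"
    unfolding k_def using p0
    by (intro continuous_intros continuous_on_subset[OF cont(1) sub] continuous_on_subset[OF cont(2) sub] ballI)
  then have "bounded (k ` {a..b})"
    using compact_continuous_image compact_imp_bounded by blast
  then obtain K where "\<forall>z\<in>k ` {a..b}. norm z \<le> K"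
    unfolding bounded_iff by blast
  then have K: "\<bar>k y\<bar> \<le> K" if "a \<le> y" "y \<le> b" for y
    using that by simp
  have dE: "(E has_real_derivative 2 * (f y * F y) * k y) (at y)" if "a \<le> y" "y \<le> b" for y
  proof -
    have y: "-1 < y" "y < 1" using that ab by auto
    have "p y \<noteq> 0" using pos[OF y] by simp
    moreover have "(F has_real_derivative - q y * f y) (at y)"
      unfolding F_def[abs_def] using SL_solutionD(2)[OF f y] .
    ultimately have "(E has_real_derivative 2 * f y * f' y + 2 * F y * (- q y * f y)) (at y)"
      unfolding E_def[abs_def] using SL_solutionD(1)[OF f y] by (auto intro!: derivative_eq_intros)
    moreover have "f' y = F y / p y"
      using \<open>p y \<noteq> 0\<close> by (simp add: F_def)
    then have "2 * f y * f' y + 2 * F y * (- q y * f y) = 2 * (f y * F y) * k y"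
      unfolding k_def by (simp add: algebra_simps)
    ultimately show ?thesis by simp
  qed
  have bound: "\<bar>2 * (f y * F y) * k y\<bar> \<le> K * E y" if "a \<le> y" "y \<le> b" for y
  proof -
    have "\<bar>2 * (f y * F y)\<bar> \<le> E y"
      unfolding E_def
      using sum_squares_bound[of "\<bar>f y\<bar>" "\<bar>F y\<bar>"] by (simp add: abs_mult mult.assoc)
    then have "\<bar>2 * (f y * F y)\<bar> * \<bar>k y\<bar> \<le> E y * K"
      using K[OF that] by (intro mult_mono) (auto simp: E_def)
    then show ?thesis by (simp add: abs_mult mult.commute)
  qed
  have "E x0 = 0" using init by (simp add: E_def F_def)
  have "E x \<le> 0"
  proof (cases "x0 \<le> x")
    case True
    have "E x * exp (- K * x) \<le> E x0 * exp (- K * x0)"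
    proof (rule DERIV_nonpos_imp_nonincreasing[OF True])
      fix y assume "x0 \<le> y" "y \<le> x"
      then have y: "a \<le> y" "y \<le> b" using ab by auto
      have "((\<lambda>y. E y * exp (- K * y)) has_real_derivative
          (2 * (f y * F y) * k y - K * E y) * exp (- K * y)) (at y)"
        by (auto intro!: derivative_eq_intros dE[OF y] simp: algebra_simps)
      moreover have "(2 * (f y * F y) * k y - K * E y) * exp (- K * y) \<le> 0"
        using bound[OF y] by (intro mult_nonpos_nonneg) auto
      ultimately show "\<exists>z. ((\<lambda>y. E y * exp (- K * y)) has_real_derivative z) (at y) \<and> z \<le> 0"
        by blast
    qed
    then show ?thesis using \<open>E x0 = 0\<close> by (simp add: mult_le_0_iff)
  next
    case False
    then have le: "x \<le> x0" by simp
    have "E x * exp (K * x) \<le> E x0 * exp (K * x0)"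
    proof (rule DERIV_nonneg_imp_nondecreasing[OF le])
      fix y assume "x \<le> y" "y \<le> x0"
      then have y: "a \<le> y" "y \<le> b" using ab by auto
      have "((\<lambda>y. E y * exp (K * y)) has_real_derivative
          (2 * (f y * F y) * k y + K * E y) * exp (K * y)) (at y)"
        by (auto intro!: derivative_eq_intros dE[OF y] simp: algebra_simps)
      moreover have "0 \<le> (2 * (f y * F y) * k y + K * E y) * exp (K * y)"
        using bound[OF y] by (intro mult_nonneg_nonneg) auto
      ultimately show "\<exists>z. ((\<lambda>y. E y * exp (K * y)) has_real_derivative z) (at y) \<and> 0 \<le> z"
        by blast
    qed
    then show ?thesis using \<open>E x0 = 0\<close> by (simp add: mult_le_0_iff)
  qed
  moreover have "(f x)\<^sup>2 \<le> E x" by (simp add: E_def)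
  ultimately show ?thesis by (metis order.trans power2_less_eq_zero_iff)
qed

section \<open>The Frobenius series at the right end\<close>

text \<open>
  In the variable \<open>s = 1 - x\<close> the equation reads
  \<open>s (2 - s) f'' + 2 (\<alpha> + 1) (1 - s) f' + (l - c\<^sup>2 (1 - s)\<^sup>2) f = 0\<close>. The coefficient of \<open>s ^ k\<close> in its
  power series solution is \<open>frob (k + 2)\<close>: the two leading zeros play the role of the coefficients
  of index \<open>-2\<close> and \<open>-1\<close> and make the recurrence uniform in \<open>k\<close>.
\<close>

fun frob :: "real \<Rightarrow> real \<Rightarrow> real \<Rightarrow> nat \<Rightarrow> real" where
  "frob \<alpha> c l 0 = 0"
| "frob \<alpha> c l (Suc 0) = 0"
| "frob \<alpha> c l (Suc (Suc 0)) = 1"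
| "frob \<alpha> c l (Suc (Suc (Suc k))) =
     ((real k * (real k + 2 * \<alpha> + 1) - l + c\<^sup>2) * frob \<alpha> c l (Suc (Suc k))
       - 2 * c\<^sup>2 * frob \<alpha> c l (Suc k) + c\<^sup>2 * frob \<alpha> c l k)
     / (2 * (real k + 1) * (real k + 1 + \<alpha>))"

text \<open>
  The recurrence of \<open>frob\<close> with all signs positive and \<open>- l\<close> replaced by \<open>B\<close>; it dominates \<open>frob\<close>
  uniformly for \<open>\<bar>l\<bar> \<le> B\<close>, which gives continuity in \<open>l\<close>.
\<close>

fun frob_major :: "real \<Rightarrow> real \<Rightarrow> real \<Rightarrow> nat \<Rightarrow> real" where
  "frob_major \<alpha> c B 0 = 0"
| "frob_major \<alpha> c B (Suc 0) = 0"
| "frob_major \<alpha> c B (Suc (Suc 0)) = 1"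
| "frob_major \<alpha> c B (Suc (Suc (Suc k))) =
     ((real k * (real k + 2 * \<alpha> + 1) + B + c\<^sup>2) * frob_major \<alpha> c B (Suc (Suc k))
       + 2 * c\<^sup>2 * frob_major \<alpha> c B (Suc k) + c\<^sup>2 * frob_major \<alpha> c B k)
     / (2 * (real k + 1) * (real k + 1 + \<alpha>))"

definition reg_fps :: "real \<Rightarrow> real \<Rightarrow> real \<Rightarrow> real fps" where
  "reg_fps \<alpha> c l = Abs_fps (\<lambda>k. frob \<alpha> c l (k + 2))"

definition major_fps :: "real \<Rightarrow> real \<Rightarrow> real \<Rightarrow> real fps" where
  "major_fps \<alpha> c B = Abs_fps (\<lambda>k. frob_major \<alpha> c B (k + 2))"

definition reg :: "real \<Rightarrow> real \<Rightarrow> real \<Rightarrow> real \<Rightarrow> real" where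
  "reg \<alpha> c l x = eval_fps (reg_fps \<alpha> c l) (1 - x)"

definition reg' :: "real \<Rightarrow> real \<Rightarrow> real \<Rightarrow> real \<Rightarrow> real" where
  "reg' \<alpha> c l x = - eval_fps (fps_deriv (reg_fps \<alpha> c l)) (1 - x)"

text \<open>
  In the limit the recurrence becomes \<open>A (k + 3) = A (k + 2) / 2\<close>; hence every rate above \<open>1 / 2\<close>
  is eventually reproduced by the recurrence, and a large constant takes care of the initial terms.
\<close>

lemma three_term_growth:
  fixes A x y z :: "nat \<Rightarrow> real"
  assumes A0: "\<And>k. 0 \<le> A k"
    and xyz: "\<And>k. 0 \<le> x k" "\<And>k. 0 \<le> y k" "\<And>k. 0 \<le> z k"
    and rec: "\<And>k. A (k + 3) \<le> x k * A (k + 2) + y k * A (k + 1) + z k * A k"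
    and lim: "x \<longlonglongrightarrow> 1 / 2" "y \<longlonglongrightarrow> 0" "z \<longlonglongrightarrow> 0"
    and r: "1 / 2 < r"
  shows "\<exists>M. \<forall>k. A k \<le> M * r ^ k"
proof -
  have "(\<lambda>k. x k * r\<^sup>2 + y k * r + z k) \<longlonglongrightarrow> 1 / 2 * r\<^sup>2 + 0 * r + 0"
    by (intro tendsto_intros lim)
  moreover have "1 / 2 * r\<^sup>2 + 0 * r + 0 < r ^ 3"
    using r by (simp add: power2_eq_square power3_eq_cube)
  ultimately have "eventually (\<lambda>k. x k * r\<^sup>2 + y k * r + z k < r ^ 3) sequentially"
    by (rule order_tendstoD)
  then obtain K where K: "\<And>k. K \<le> k \<Longrightarrow> x k * r\<^sup>2 + y k * r + z k \<le> r ^ 3"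
    unfolding eventually_sequentially by (meson less_imp_le)
  \<comment> \<open>Large enough for the claim up to index \<open>K + 2\<close>, where the induction starts.\<close>
  define M where "M = (\<Sum>j\<le>K + 2. A j / r ^ j)"
  have M0: "0 \<le> M"
    unfolding M_def using A0 r by (intro sum_nonneg) simp
  have "A k \<le> M * r ^ k" for k
  proof (induction k rule: less_induct)
    case (less k)
    show ?case
    proof (cases "k \<le> K + 2")
      case True
      then have "A k / r ^ k \<le> M"
        unfolding M_def using A0 r by (intro member_le_sum[where f = "\<lambda>j. A j / r ^ j"]) auto
      then show ?thesis using r by (simp add: field_simps)
    next
      case False
      then obtain m where k: "k = m + 3" and m: "K \<le> m"
        using le_Suc_ex[of "K + 3" k] by (metis add.assoc add.commute le_add1 not_less_eq_eq numeral_2_eq_2 numeral_3_eq_3 add_Suc_right)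
      have "A k \<le> x m * A (m + 2) + y m * A (m + 1) + z m * A m"
        unfolding k by (rule rec)
      also have "\<dots> \<le> x m * (M * r ^ (m + 2)) + y m * (M * r ^ (m + 1)) + z m * (M * r ^ m)"
        using xyz k by (intro add_mono mult_left_mono less.IH) auto
      also have "\<dots> = M * r ^ m * (x m * r\<^sup>2 + y m * r + z m)"
        by (simp add: algebra_simps power2_eq_square)
      also have "\<dots> \<le> M * r ^ m * r ^ 3"
        using M0 r K[OF m] by (intro mult_left_mono) auto
      finally show ?thesis by (simp add: k power_add)
    qed
  qed
  then show ?thesis by blast
qed

lemma frob_major_nonneg:
  assumes "0 \<le> \<alpha>" "0 \<le> B"
  shows "0 \<le> frob_major \<alpha> c B k"
  using assms by (induction \<alpha> c B k rule: frob_major.induct) (auto intro!: divide_nonneg_nonneg add_nonneg_nonneg mult_nonneg_nonneg)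

lemma abs_frob_le_major:
  assumes "0 \<le> \<alpha>" "\<bar>l\<bar> \<le> B"
  shows "\<bar>frob \<alpha> c l k\<bar> \<le> frob_major \<alpha> c B k"
  using assms
proof (induction \<alpha> c l k rule: frob.induct)
  case (4 \<alpha> c l k)
  let ?f = "frob \<alpha> c l" and ?m = "frob_major \<alpha> c B" and ?d = "2 * (real k + 1) * (real k + 1 + \<alpha>)"
  have d: "0 < ?d" using 4 by (simp add: add_pos_nonneg)
  have "\<bar>(real k * (real k + 2 * \<alpha> + 1) - l + c\<^sup>2) * ?f (Suc (Suc k))
       - 2 * c\<^sup>2 * ?f (Suc k) + c\<^sup>2 * ?f k\<bar> \<le>
      \<bar>real k * (real k + 2 * \<alpha> + 1) - l + c\<^sup>2\<bar> * \<bar>?f (Suc (Suc k))\<bar>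
       + 2 * c\<^sup>2 * \<bar>?f (Suc k)\<bar> + c\<^sup>2 * \<bar>?f k\<bar>"
    by (auto simp: abs_mult intro!: order_trans[OF abs_triangle_ineq] order_trans[OF abs_triangle_ineq4] add_mono)
  also have "\<dots> \<le> (real k * (real k + 2 * \<alpha> + 1) + B + c\<^sup>2) * ?m (Suc (Suc k))
       + 2 * c\<^sup>2 * ?m (Suc k) + c\<^sup>2 * ?m k"
  proof -
    have "0 \<le> real k * (real k + 2 * \<alpha> + 1)" using 4 by simp
    then have "\<bar>real k * (real k + 2 * \<alpha> + 1) - l + c\<^sup>2\<bar> \<le> real k * (real k + 2 * \<alpha> + 1) + B + c\<^sup>2"
      using 4 zero_le_power2[of c] by linarith
    then show ?thesis
      using 4 by (intro add_mono mult_mono mult_left_mono) auto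
  qed
  finally show ?case
    using d by (simp add: abs_divide divide_right_mono)
qed auto

lemma frob_major_growth:
  assumes "0 \<le> \<alpha>" "0 \<le> B" "1 / 2 < r"
  shows "\<exists>M. \<forall>k. frob_major \<alpha> c B k \<le> M * r ^ k"
proof (rule three_term_growth)
  let ?d = "\<lambda>k. 2 * (real k + 1) * (real k + 1 + \<alpha>)"
  let ?x = "\<lambda>k. (real k * (real k + 2 * \<alpha> + 1) + B + c\<^sup>2) / ?d k"
  let ?y = "\<lambda>k. 2 * c\<^sup>2 / ?d k" and ?z = "\<lambda>k. c\<^sup>2 / ?d k"
  show "frob_major \<alpha> c B (k + 3) \<le> ?x k * frob_major \<alpha> c B (k + 2)
      + ?y k * frob_major \<alpha> c B (k + 1) + ?z k * frob_major \<alpha> c B k" for k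
    by (simp add: numeral_3_eq_3 add_divide_distrib algebra_simps)
  show "?x \<longlonglongrightarrow> 1 / 2" by real_asymp
  show "?y \<longlonglongrightarrow> 0" by real_asymp
  show "?z \<longlonglongrightarrow> 0" by real_asymp
qed (use assms frob_major_nonneg in auto)

lemma summable_frob_major:
  assumes "0 \<le> \<alpha>" "0 \<le> B" "0 < r" "r < 2"
  shows "summable (\<lambda>k. frob_major \<alpha> c B (k + 2) * r ^ k)"
proof -
  define q where "q = (1 / 2 + 1 / r) / 2"
  have q: "1 / 2 < q" "q * r < 1" "0 < q"
    using assms by (auto simp: q_def field_simps)
  obtain M where M: "\<And>k. frob_major \<alpha> c B k \<le> M * q ^ k"
    using frob_major_growth[OF assms(1,2) q(1)] by blast
  have "summable (\<lambda>k. M * q\<^sup>2 * (q * r) ^ k)"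
    using q assms by (intro summable_mult summable_geometric) auto
  then show ?thesis
  proof (rule summable_comparison_test_ev[rotated], intro always_eventually allI)
    fix k
    have "frob_major \<alpha> c B (k + 2) * r ^ k \<le> M * q ^ (k + 2) * r ^ k"
      using assms(3) by (intro mult_right_mono M) simp
    then show "norm (frob_major \<alpha> c B (k + 2) * r ^ k) \<le> M * q\<^sup>2 * (q * r) ^ k"
      using assms frob_major_nonneg[OF assms(1,2), of c "k + 2"]
      by (simp add: abs_mult abs_of_nonneg power2_eq_square power_add power_mult_distrib mult_ac)
  qed
qed

text \<open>
  The other singular point \<open>x = -1\<close> lies at distance \<open>2\<close>; the series converges up to it.
\<close>

lemma conv_radius_reg_fps:
  assumes "0 \<le> \<alpha>"
  shows "2 \<le> fps_conv_radius (reg_fps \<alpha> c l)" and "2 \<le> fps_conv_radius (fps_deriv (reg_fps \<alpha> c l))"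
proof -
  show 1: "2 \<le> fps_conv_radius (reg_fps \<alpha> c l)"
    unfolding fps_conv_radius_def
  proof (rule conv_radius_geI_ex')
    fix r :: real assume r: "0 < r" "ereal r < 2"
    then have "r < 2" by simp
    then have "summable (\<lambda>k. frob_major \<alpha> c \<bar>l\<bar> (k + 2) * r ^ k)"
      using summable_frob_major[OF assms, of "\<bar>l\<bar>" r] r by simp
    then show "summable (\<lambda>k. fps_nth (reg_fps \<alpha> c l) k * of_real r ^ k)"
      using abs_frob_le_major[OF assms order_refl, where l = l and c = c] r
      by (elim summable_comparison_test_ev[rotated], intro always_eventually allI)
        (auto simp: reg_fps_def abs_mult intro!: mult_right_mono)
  qed
  show "2 \<le> fps_conv_radius (fps_deriv (reg_fps \<alpha> c l))"
    using fps_conv_radius_deriv[of "reg_fps \<alpha> c l"] 1 by (rule order_trans[rotated])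
qed

lemma sums_shift:
  fixes a :: "nat \<Rightarrow> real"
  assumes "(\<lambda>k. a k * s ^ k) sums S"
  shows "(\<lambda>k. (case k of 0 \<Rightarrow> 0 | Suc j \<Rightarrow> a j) * s ^ k) sums (s * S)"
  using sums_Suc[of "\<lambda>k. (case k of 0 \<Rightarrow> 0 | Suc j \<Rightarrow> a j) * s ^ k" "s * S"]
    sums_mult[OF assms, of s] by (simp add: mult_ac)

text \<open>
  Multiplication of a power series by \<open>s\<close> shifts its coefficients; collecting the coefficient of
  \<open>s ^ k\<close> in the equation leaves the recurrence of \<open>frob\<close>.
\<close>

lemma frobenius_ode:
  fixes \<alpha> c l s :: real
  assumes "0 \<le> \<alpha>" "\<bar>s\<bar> < 2"
  defines "F \<equiv> reg_fps \<alpha> c l"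
  shows "s * (2 - s) * eval_fps (fps_deriv (fps_deriv F)) s
    + 2 * (\<alpha> + 1) * (1 - s) * eval_fps (fps_deriv F) s
    + (l - c\<^sup>2 * (1 - s)\<^sup>2) * eval_fps F s = 0"
proof -
  define a where "a = fps_nth F"
  define d where "d k = (real k + 1) * a (Suc k)" for k
  define e where "e k = (real k + 1) * d (Suc k)" for k
  define sh :: "(nat \<Rightarrow> real) \<Rightarrow> nat \<Rightarrow> real" where "sh b k = (case k of 0 \<Rightarrow> 0 | Suc j \<Rightarrow> b j)" for b k
  have rad: "2 \<le> fps_conv_radius F" "2 \<le> fps_conv_radius (fps_deriv F)"
    using conv_radius_reg_fps[OF assms(1)] by (auto simp: F_def)
  then have rad2: "2 \<le> fps_conv_radius (fps_deriv (fps_deriv F))"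
    using fps_conv_radius_deriv order_trans by blast
  have s2: "ereal (norm s) < 2" using assms(2) by simp
  have "(\<lambda>k. fps_nth F k * s ^ k) sums eval_fps F s"
    "(\<lambda>k. fps_nth (fps_deriv F) k * s ^ k) sums eval_fps (fps_deriv F) s"
    "(\<lambda>k. fps_nth (fps_deriv (fps_deriv F)) k * s ^ k) sums eval_fps (fps_deriv (fps_deriv F)) s"
    by (intro sums_eval_fps less_le_trans[OF s2] rad rad2)+
  moreover have "fps_nth (fps_deriv F) = d" "fps_nth (fps_deriv (fps_deriv F)) = e"
    by (auto simp: fun_eq_iff d_def e_def a_def algebra_simps)
  ultimately have S: "(\<lambda>k. a k * s ^ k) sums eval_fps F s"
    "(\<lambda>k. d k * s ^ k) sums eval_fps (fps_deriv F) s"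
    "(\<lambda>k. e k * s ^ k) sums eval_fps (fps_deriv (fps_deriv F)) s"
    by (auto simp: a_def)
  have shift: "(\<lambda>k. sh b k * s ^ k) sums (s * S)" if "(\<lambda>k. b k * s ^ k) sums S" for b S
    unfolding sh_def using sums_shift[OF that] .
  have total: "(\<lambda>k. 2 * (sh e k * s ^ k) - sh (sh e) k * s ^ k + 2 * (\<alpha> + 1) * (d k * s ^ k - sh d k * s ^ k)
      + (l - c\<^sup>2) * (a k * s ^ k) + 2 * c\<^sup>2 * (sh a k * s ^ k) - c\<^sup>2 * (sh (sh a) k * s ^ k)) sums
      (2 * (s * eval_fps (fps_deriv (fps_deriv F)) s) - s * (s * eval_fps (fps_deriv (fps_deriv F)) s)
      + 2 * (\<alpha> + 1) * (eval_fps (fps_deriv F) s - s * eval_fps (fps_deriv F) s)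
      + (l - c\<^sup>2) * eval_fps F s + 2 * c\<^sup>2 * (s * eval_fps F s) - c\<^sup>2 * (s * (s * eval_fps F s)))"
    by (intro sums_add sums_diff sums_mult shift S)
  have zero: "2 * sh e k - sh (sh e) k + 2 * (\<alpha> + 1) * (d k - sh d k)
      + (l - c\<^sup>2) * a k + 2 * c\<^sup>2 * sh a k - c\<^sup>2 * sh (sh a) k = 0" for k
  proof -
    let ?f = "frob \<alpha> c l"
    have pos: "2 * (real k + 1) * (real k + 1 + \<alpha>) \<noteq> 0" using assms(1) by (simp add: add_nonneg_eq_0_iff)
    have af: "a j = ?f (Suc (Suc j))" for j by (simp add: a_def F_def reg_fps_def)
    have rec: "2 * (real k + 1) * (real k + 1 + \<alpha>) * ?f (Suc (Suc (Suc k))) =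
      (real k * (real k + 2 * \<alpha> + 1) - l + c\<^sup>2) * ?f (Suc (Suc k)) - 2 * c\<^sup>2 * ?f (Suc k) + c\<^sup>2 * ?f k"
      using pos by simp
    have "sh a k = ?f (Suc k)"
      by (cases k) (auto simp: sh_def af)
    moreover have "sh (sh a) k = ?f k"
      by (cases k; cases "k - 1"; simp add: sh_def af)
    moreover have "sh e k = real k * d k" "sh d k = real k * a k"
      by (cases k; simp add: sh_def e_def d_def)+
    moreover have "sh (sh e) k = real k * (real k - 1) * a k"
      by (cases k; cases "k - 1"; simp add: sh_def e_def d_def)
    moreover have "d k = (real k + 1) * ?f (Suc (Suc (Suc k)))" "a k = ?f (Suc (Suc k))"
      by (simp_all add: d_def af)
    ultimately have "2 * sh e k - sh (sh e) k + 2 * (\<alpha> + 1) * (d k - sh d k)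
        + (l - c\<^sup>2) * a k + 2 * c\<^sup>2 * sh a k - c\<^sup>2 * sh (sh a) k
      = 2 * (real k + 1) * (real k + 1 + \<alpha>) * ?f (Suc (Suc (Suc k)))
        - ((real k * (real k + 2 * \<alpha> + 1) - l + c\<^sup>2) * ?f (Suc (Suc k)) - 2 * c\<^sup>2 * ?f (Suc k) + c\<^sup>2 * ?f k)"
      by (simp only:) (simp add: algebra_simps del: frob.simps)
    then show ?thesis
      by (simp only: rec diff_self)
  qed
  have "2 * (sh e k * s ^ k) - sh (sh e) k * s ^ k + 2 * (\<alpha> + 1) * (d k * s ^ k - sh d k * s ^ k)
      + (l - c\<^sup>2) * (a k * s ^ k) + 2 * c\<^sup>2 * (sh a k * s ^ k) - c\<^sup>2 * (sh (sh a) k * s ^ k) = 0" for k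
    using arg_cong[OF zero[of k], of "\<lambda>t. t * s ^ k"] by (simp add: algebra_simps)
  then have "2 * (s * eval_fps (fps_deriv (fps_deriv F)) s) - s * (s * eval_fps (fps_deriv (fps_deriv F)) s)
      + 2 * (\<alpha> + 1) * (eval_fps (fps_deriv F) s - s * eval_fps (fps_deriv F) s)
      + (l - c\<^sup>2) * eval_fps F s + 2 * c\<^sup>2 * (s * eval_fps F s) - c\<^sup>2 * (s * (s * eval_fps F s)) = 0"
    using total by (simp only: sums_unique2[OF _ sums_zero])
  then show ?thesis by (simp add: algebra_simps power2_eq_square)
qed

lemma continuous_on_frob [continuous_intros]: "continuous_on S (\<lambda>l. frob \<alpha> c l k)"
proof -
  have "continuous_on UNIV (\<lambda>l. frob \<alpha> c l k)"
    by (induction \<alpha> c "0 :: real" k rule: frob.induct)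
      (auto intro!: continuous_intros simp: divide_inverse)
  then show ?thesis by (rule continuous_on_subset) simp
qed

section \<open>The solution that is regular at the right end\<close>

text \<open>
  The coefficients \<open>p\<close> and \<open>q\<close> of the eigenvalue equation in the form \<open>(p f')' = - q f\<close>.
\<close>

definition flux_coeff :: "real \<Rightarrow> real \<Rightarrow> real" where
  "flux_coeff \<alpha> x = weight \<alpha> x * (1 - x\<^sup>2)"

definition mass_coeff :: "real \<Rightarrow> real \<Rightarrow> real \<Rightarrow> real \<Rightarrow> real" where
  "mass_coeff \<alpha> c l x = (l - c\<^sup>2 * x\<^sup>2) * weight \<alpha> x"

lemma one_minus_square_pos: "-1 < x \<Longrightarrow> x < 1 \<Longrightarrow> 0 < 1 - x\<^sup>2" for x :: real
  by (simp add: abs_square_less_1 abs_less_iff)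

lemma one_minus_square_nonneg: "-1 \<le> x \<Longrightarrow> x \<le> 1 \<Longrightarrow> 0 \<le> 1 - x\<^sup>2" for x :: real
  by (simp add: abs_square_le_1 abs_le_iff)

lemma weight_pos: "-1 < x \<Longrightarrow> x < 1 \<Longrightarrow> 0 < weight \<alpha> x"
  using one_minus_square_pos[of x] by (simp add: weight_def)

lemma weight_minus [simp]: "weight \<alpha> (- x) = weight \<alpha> x"
  by (simp add: weight_def)

lemma flux_coeff_minus [simp]: "flux_coeff \<alpha> (- x) = flux_coeff \<alpha> x"
  by (simp add: flux_coeff_def)

lemma mass_coeff_minus [simp]: "mass_coeff \<alpha> c l (- x) = mass_coeff \<alpha> c l x"
  by (simp add: mass_coeff_def)

lemma flux_coeff_0 [simp]: "flux_coeff \<alpha> 0 = 1"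
  by (simp add: flux_coeff_def weight_def)

lemma flux_coeff_pos: "-1 < x \<Longrightarrow> x < 1 \<Longrightarrow> 0 < flux_coeff \<alpha> x"
  using one_minus_square_pos[of x] weight_pos[of x \<alpha>] by (simp add: flux_coeff_def)

text \<open>
  Unlike the weight, which for \<open>\<alpha> = 0\<close> jumps to \<open>0\<close> at the end points because \<open>0 powr 0 = 0\<close>, this
  function is continuous on the closed interval.
\<close>

lemma flux_coeff_powr: "-1 \<le> x \<Longrightarrow> x \<le> 1 \<Longrightarrow> flux_coeff \<alpha> x = (1 - x\<^sup>2) powr (\<alpha> + 1)"
  using one_minus_square_nonneg[of x]
  by (simp add: flux_coeff_def weight_def powr_mult_base mult.commute add.commute)

lemma weight_le_1:
  assumes "0 \<le> \<alpha>" "-1 \<le> x" "x \<le> 1"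
  shows "weight \<alpha> x \<le> 1"
  using powr_mono2[OF assms(1), of "1 - x\<^sup>2" 1] one_minus_square_nonneg[OF assms(2,3)]
  by (simp add: weight_def)

lemma flux_coeff_le:
  assumes "0 \<le> \<alpha>" "-1 \<le> x" "x \<le> 1"
  shows "flux_coeff \<alpha> x \<le> 1 - x\<^sup>2"
  using weight_le_1[OF assms] one_minus_square_nonneg[OF assms(2,3)]
  by (simp add: flux_coeff_def mult_left_le_one_le weight_def)

lemma continuous_on_flux_coeff: "0 \<le> \<alpha> \<Longrightarrow> continuous_on {-1..1} (flux_coeff \<alpha>)"
proof -
  assume "0 \<le> \<alpha>"
  then have "continuous_on {-1..1} (\<lambda>x. (1 - x\<^sup>2) powr (\<alpha> + 1))"
    by (intro continuous_on_powr' continuous_intros) (auto dest: one_minus_square_nonneg[THEN diff_ge_0_iff_ge[THEN iffD1]])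
  then show ?thesis
    by (subst continuous_on_cong[OF refl flux_coeff_powr]) auto
qed

lemma continuous_on_weight: "continuous_on {-1<..<1} (weight \<alpha>)"
  unfolding weight_def[abs_def]
  by (intro continuous_on_powr continuous_intros) (auto simp: power2_eq_1_iff)

lemma continuous_on_mass_coeff: "continuous_on {-1<..<1} (mass_coeff \<alpha> c l)"
  unfolding mass_coeff_def[abs_def] by (intro continuous_intros continuous_on_weight)

lemma weight_has_derivative:
  assumes "-1 < x" "x < 1"
  shows "(weight \<alpha> has_real_derivative - 2 * \<alpha> * x * weight \<alpha> x / (1 - x\<^sup>2)) (at x)"
proof -
  have pos: "0 < 1 - x\<^sup>2" using one_minus_square_pos[OF assms] .
  have "((\<lambda>x. (1 - x\<^sup>2) powr \<alpha>) has_real_derivative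
      (\<alpha> * (1 - x\<^sup>2) powr (\<alpha> - 1)) * (- 2 * x)) (at x)"
    using pos by (auto intro!: derivative_eq_intros simp: powr_diff field_simps)
  then show ?thesis
    using pos by (simp add: weight_def[abs_def] powr_diff mult_ac)
qed

lemma flux_coeff_has_derivative:
  assumes "-1 < x" "x < 1"
  shows "(flux_coeff \<alpha> has_real_derivative - 2 * (\<alpha> + 1) * x * weight \<alpha> x) (at x)"
proof -
  have pos: "1 - x\<^sup>2 \<noteq> 0" using one_minus_square_pos[OF assms] by simp
  have "(flux_coeff \<alpha> has_real_derivative
     (- 2 * \<alpha> * x * weight \<alpha> x / (1 - x\<^sup>2)) * (1 - x\<^sup>2) + (- 2 * x) * weight \<alpha> x) (at x)"
    unfolding flux_coeff_def[abs_def]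
    by (auto intro!: derivative_eq_intros weight_has_derivative assms simp: mult.commute)
  moreover have "(- 2 * \<alpha> * x * weight \<alpha> x / (1 - x\<^sup>2)) * (1 - x\<^sup>2) + (- 2 * x) * weight \<alpha> x
      = - 2 * (\<alpha> + 1) * x * weight \<alpha> x"
    using pos by (simp add: divide_simps) (simp add: algebra_simps)
  ultimately show ?thesis by simp
qed

lemma reg_has_derivative:
  assumes "0 \<le> \<alpha>" "-1 < x" "x < 3"
  shows "(reg \<alpha> c l has_real_derivative reg' \<alpha> c l x) (at x)"
    and "(reg' \<alpha> c l has_real_derivative eval_fps (fps_deriv (fps_deriv (reg_fps \<alpha> c l))) (1 - x)) (at x)"
proof -
  have x: "ereal (norm (1 - x)) < 2" using assms by simp
  have *: "((\<lambda>x. eval_fps F (1 - x)) has_real_derivative - eval_fps (fps_deriv F) (1 - x)) (at x)"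
    if "2 \<le> fps_conv_radius F" for F :: "real fps"
    by (rule DERIV_chain2[where f = "eval_fps F" and g = "\<lambda>x. 1 - x", OF has_field_derivative_eval_fps[OF less_le_trans[OF x that]], THEN DERIV_cong])
      (auto intro!: derivative_eq_intros)
  show "(reg \<alpha> c l has_real_derivative reg' \<alpha> c l x) (at x)"
    unfolding reg_def[abs_def] reg'_def using *[OF conv_radius_reg_fps(1)[OF assms(1)]] .
  show "(reg' \<alpha> c l has_real_derivative eval_fps (fps_deriv (fps_deriv (reg_fps \<alpha> c l))) (1 - x)) (at x)"
    unfolding reg'_def[abs_def] using DERIV_minus[OF *[OF conv_radius_reg_fps(2)[OF assms(1)]]] by simp
qed

lemma SL_solution_reg:
  assumes "0 \<le> \<alpha>"
  shows "SL_solution (flux_coeff \<alpha>) (mass_coeff \<alpha> c l) (reg \<alpha> c l) (reg' \<alpha> c l)"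
  unfolding SL_solution_def
proof (intro ballI conjI)
  fix x :: real assume "x \<in> {-1<..<1}"
  then have x: "-1 < x" "x < 1" by auto
  let ?F = "reg_fps \<alpha> c l"
  show "(reg \<alpha> c l has_real_derivative reg' \<alpha> c l x) (at x)"
    using reg_has_derivative(1) assms x by simp
  have "((\<lambda>t. flux_coeff \<alpha> t * reg' \<alpha> c l t) has_real_derivative
      (- 2 * (\<alpha> + 1) * x * weight \<alpha> x) * reg' \<alpha> c l x
      + eval_fps (fps_deriv (fps_deriv ?F)) (1 - x) * flux_coeff \<alpha> x) (at x)"
    using x by (intro DERIV_mult flux_coeff_has_derivative reg_has_derivative(2) assms) auto
  moreover have "(1 - x) * (2 - (1 - x)) * eval_fps (fps_deriv (fps_deriv ?F)) (1 - x)
    + 2 * (\<alpha> + 1) * (1 - (1 - x)) * eval_fps (fps_deriv ?F) (1 - x)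
    + (l - c\<^sup>2 * (1 - (1 - x))\<^sup>2) * eval_fps ?F (1 - x) = 0"
    using x by (intro frobenius_ode assms) auto
  then have "weight \<alpha> x * ((1 - x) * (2 - (1 - x)) * eval_fps (fps_deriv (fps_deriv ?F)) (1 - x)
    + 2 * (\<alpha> + 1) * (1 - (1 - x)) * eval_fps (fps_deriv ?F) (1 - x)
    + (l - c\<^sup>2 * (1 - (1 - x))\<^sup>2) * eval_fps ?F (1 - x)) = 0" by simp
  then have "(- 2 * (\<alpha> + 1) * x * weight \<alpha> x) * reg' \<alpha> c l x
      + eval_fps (fps_deriv (fps_deriv ?F)) (1 - x) * flux_coeff \<alpha> x
      = - mass_coeff \<alpha> c l x * reg \<alpha> c l x"
    by (simp add: reg_def reg'_def flux_coeff_def mass_coeff_def algebra_simps power2_eq_square)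
  ultimately show "((\<lambda>t. flux_coeff \<alpha> t * reg' \<alpha> c l t) has_real_derivative
      - mass_coeff \<alpha> c l x * reg \<alpha> c l x) (at x)" by simp
qed

lemma reg_1 [simp]: "reg \<alpha> c l 1 = 1"
  by (simp add: reg_def eval_fps_at_0 reg_fps_def numeral_2_eq_2)

lemma reg_tendsto_1:
  assumes "0 \<le> \<alpha>"
  shows "(reg \<alpha> c l \<longlongrightarrow> 1) (at_left 1)"
proof -
  have "isCont (reg \<alpha> c l) 1"
    using reg_has_derivative(1)[OF assms, of 1, THEN DERIV_isCont] by simp
  then show ?thesis
    by (auto simp: isCont_def intro: tendsto_within_subset)
qed

lemma regular_end_reg:
  assumes "0 \<le> \<alpha>"
  shows "regular_end (flux_coeff \<alpha>) (reg \<alpha> c l) (reg' \<alpha> c l) (at_left 1)"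
proof -
  have "(reg' \<alpha> c l \<longlongrightarrow> reg' \<alpha> c l 1) (at 1)"
    using reg_has_derivative(2)[OF assms, of 1 c l, THEN DERIV_isCont] by (simp add: isCont_def)
  then have lim: "(reg' \<alpha> c l \<longlongrightarrow> reg' \<alpha> c l 1) (at_left 1)"
    by (rule tendsto_within_subset) simp
  have "(flux_coeff \<alpha> \<longlongrightarrow> flux_coeff \<alpha> 1) (at 1 within {-1..1})"
    using continuous_on_flux_coeff[OF assms] by (auto simp: continuous_on_def)
  then have "(flux_coeff \<alpha> \<longlongrightarrow> 0) (at_left 1)"
    by (simp add: at_within_Icc_at_left flux_coeff_def)
  from tendsto_mult[OF this lim] reg_tendsto_1[OF assms] show ?thesis
    unfolding regular_end_def by (auto intro!: exI[of _ 1])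
qed

lemma reg_simple_zero:
  assumes "0 \<le> \<alpha>" "-1 < x" "x < 1" "reg \<alpha> c l x = 0"
  shows "reg' \<alpha> c l x \<noteq> 0"
proof
  assume "reg' \<alpha> c l x = 0"
  moreover have "continuous_on {-1<..<1} (flux_coeff \<alpha>)"
    by (rule continuous_on_subset[OF continuous_on_flux_coeff[OF assms(1)]]) auto
  ultimately have zero: "reg \<alpha> c l y = 0" if "-1 < y" "y < 1" for y
    using SL_solution_unique[OF SL_solution_reg[OF assms(1)] _ continuous_on_mass_coeff
        flux_coeff_pos assms(4) _ assms(2,3) that] by blast
  note reg_tendsto_1[OF assms(1), of c l]
  moreover have "eventually (\<lambda>y. reg \<alpha> c l y = 0) (at_left 1)"
    by (rule eventually_mono[OF eventually_at_left_real[of "-1"]]) (auto intro: zero)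
  then have "(reg \<alpha> c l \<longlongrightarrow> 0) (at_left 1)"
    by (rule tendsto_eventually)
  ultimately show False
    using tendsto_unique[of "at_left (1 :: real)"] by fastforce
qed

text \<open>
  Both series are dominated on \<open>0 \<le> s \<le> 1\<close>, \<open>\<bar>l\<bar> \<le> B\<close> by the coefficients of the majorant and of its
  derivative, which are summable because the radius of convergence exceeds \<open>1\<close>.
\<close>

lemma reg_jointly_continuous:
  assumes "0 \<le> \<alpha>" "0 \<le> B"
  shows "continuous_on ({0..1} \<times> {-B..B}) (\<lambda>(s, l). reg \<alpha> c l (1 - s))"
    and "continuous_on ({0..1} \<times> {-B..B}) (\<lambda>(s, l). reg' \<alpha> c l (1 - s))"
proof -
  let ?S = "{0..1} \<times> {-B..B} :: (real \<times> real) set"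
  let ?m = "major_fps \<alpha> c B"
  have *: "continuous_on ?S (\<lambda>z. \<Sum>k. g k (snd z) * fst z ^ k)"
    if g: "\<And>k. continuous_on UNIV (g k)" and "summable M"
      and M: "\<And>k l. \<bar>l\<bar> \<le> B \<Longrightarrow> \<bar>g k l\<bar> \<le> M k" for g :: "nat \<Rightarrow> real \<Rightarrow> real" and M
  proof (rule uniform_limit_theorem)
    show "uniform_limit ?S (\<lambda>n z. \<Sum>k<n. g k (snd z) * fst z ^ k) (\<lambda>z. \<Sum>k. g k (snd z) * fst z ^ k) sequentially"
    proof (rule Weierstrass_m_test[OF _ \<open>summable M\<close>])
      fix k z assume "z \<in> ?S"
      then have z: "0 \<le> fst z" "fst z \<le> 1" "\<bar>snd z\<bar> \<le> B" by auto
      have "\<bar>g k (snd z)\<bar> * fst z ^ k \<le> M k * 1"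
        using z M[OF z(3)] by (intro mult_mono power_le_one) (auto intro: order_trans[OF abs_ge_zero])
      then show "norm (g k (snd z) * fst z ^ k) \<le> M k"
        using z by (simp add: abs_mult)
    qed
    show "\<forall>\<^sub>F n in sequentially. continuous_on ?S (\<lambda>z. \<Sum>k<n. g k (snd z) * fst z ^ k)"
      by (intro always_eventually allI continuous_intros continuous_on_compose2[OF g]) auto
  qed simp
  have rad: "2 \<le> fps_conv_radius ?m"
    unfolding fps_conv_radius_def
  proof (rule conv_radius_geI_ex')
    fix r :: real assume r: "0 < r" "ereal r < 2"
    then have "r < 2" by simp
    then show "summable (\<lambda>k. fps_nth ?m k * of_real r ^ k)"
      using summable_frob_major[OF assms, of r c] r by (simp add: major_fps_def)
  qed
  have sum1: "summable (fps_nth F)" if "2 \<le> fps_conv_radius F" for F :: "real fps"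
    using summable_fps[of "1 :: real" F] less_le_trans[OF _ that, of 1] by (simp add: one_ereal_def)
  show "continuous_on ?S (\<lambda>(s, l). reg \<alpha> c l (1 - s))"
    using *[of "\<lambda>k l. frob \<alpha> c l (k + 2)" "fps_nth ?m", OF continuous_on_frob sum1[OF rad]]
      abs_frob_le_major[OF assms(1)]
    by (simp add: reg_def eval_fps_def reg_fps_def major_fps_def case_prod_beta)
  have "continuous_on ?S (\<lambda>z. \<Sum>k. (real (k + 1) * frob \<alpha> c (snd z) (k + 3)) * fst z ^ k)"
  proof (rule *[where g = "\<lambda>k l. real (k + 1) * frob \<alpha> c l (k + 3)" and M = "fps_nth (fps_deriv ?m)"])
    show "summable (fps_nth (fps_deriv ?m))"
      using sum1 rad fps_conv_radius_deriv order_trans by blast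
    show "\<bar>real (k + 1) * frob \<alpha> c l (k + 3)\<bar> \<le> fps_nth (fps_deriv ?m) k" if "\<bar>l\<bar> \<le> B" for k l
      using abs_frob_le_major[OF assms(1) that, of c "k + 3"]
      by (simp only: abs_mult fps_deriv_nth major_fps_def fps_nth_Abs_fps)
        (intro mult_mono, auto simp: numeral_3_eq_3 numeral_2_eq_2 simp del: frob.simps frob_major.simps)
  qed (intro continuous_intros)
  then have "continuous_on ?S (\<lambda>z. - (\<Sum>k. (real (k + 1) * frob \<alpha> c (snd z) (k + 3)) * fst z ^ k))"
    by (rule continuous_on_minus)
  then show "continuous_on ?S (\<lambda>(s, l). reg' \<alpha> c l (1 - s))"
    by (simp add: reg'_def eval_fps_def reg_fps_def case_prod_beta fps_deriv_nth numeral_3_eq_3 numeral_2_eq_2 del: frob.simps)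
qed

section \<open>Eigenvalues and parity\<close>

lemma SL_solution_reflect:
  assumes f: "SL_solution p q f f'" and even: "\<And>x. p (- x) = p x" "\<And>x. q (- x) = q x"
  shows "SL_solution p q (\<lambda>x. f (- x)) (\<lambda>x. - f' (- x))"
  unfolding SL_solution_def
proof (intro ballI conjI)
  fix x :: real assume "x \<in> {-1<..<1}"
  then have x: "-1 < - x" "- x < 1" by auto
  show "((\<lambda>x. f (- x)) has_real_derivative - f' (- x)) (at x)"
    using SL_solutionD(1)[OF f x] by (simp add: DERIV_mirror)
  have "((\<lambda>t. p (- t) * f' (- t)) has_real_derivative - (- q (- x) * f (- x))) (at x)"
    using SL_solutionD(2)[OF f x] by (subst (asm) DERIV_mirror) simp
  then have "((\<lambda>t. - (p (- t) * f' (- t))) has_real_derivative - (- (- q (- x) * f (- x)))) (at x)"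
    by (rule DERIV_minus)
  then show "((\<lambda>t. p t * - f' (- t)) has_real_derivative - q x * f (- x)) (at x)"
    by (simp add: even)
qed

lemma SL_solution_diff:
  assumes "SL_solution p q f f'" "SL_solution p q g g'"
  shows "SL_solution p q (\<lambda>x. f x - a * g x) (\<lambda>x. f' x - a * g' x)"
  unfolding SL_solution_def
proof (intro ballI conjI)
  fix x :: real assume "x \<in> {-1<..<1}"
  then have x: "-1 < x" "x < 1" by auto
  note F = SL_solutionD(1,2)[OF assms(1) x] and G = SL_solutionD(1,2)[OF assms(2) x]
  show "((\<lambda>x. f x - a * g x) has_real_derivative f' x - a * g' x) (at x)"
    by (rule DERIV_diff[OF F(1) DERIV_cmult[OF G(1)]])
  show "((\<lambda>t. p t * (f' t - a * g' t)) has_real_derivative - q x * (f x - a * g x)) (at x)"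
    using DERIV_diff[OF F(2) DERIV_cmult[OF G(2), of a]] by (simp add: algebra_simps)
qed

lemma flux_mass_unique:
  assumes "0 \<le> \<alpha>" "SL_solution (flux_coeff \<alpha>) (mass_coeff \<alpha> c l) f f'" "f 0 = 0" "f' 0 = 0"
    and x: "-1 < x" "x < 1"
  shows "f x = 0" "f' x = 0"
proof -
  have zero: "f y = 0" if "-1 < y" "y < 1" for y
  proof -
    have "continuous_on {-1<..<1} (flux_coeff \<alpha>)"
      by (rule continuous_on_subset[OF continuous_on_flux_coeff[OF assms(1)]]) auto
    from SL_solution_unique[OF assms(2) this continuous_on_mass_coeff flux_coeff_pos assms(3,4) _ _ that]
    show ?thesis by simp
  qed
  then show "f x = 0" using x .
  have "(f has_real_derivative f' x) (at x)"
    using SL_solutionD(1)[OF assms(2) x] .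
  then have "((\<lambda>_. 0) has_real_derivative f' x) (at x)"
    by (rule has_field_derivative_transform_within_open[of _ _ _ "{-1<..<1}"]) (use x zero in auto)
  then show "f' x = 0"
    using DERIV_unique DERIV_const by blast
qed

text \<open>
  The difference of \<open>reg (- x)\<close> and \<open>\<plusminus> reg x\<close> is a solution with vanishing data at \<open>0\<close>.
\<close>

lemma reg_parity:
  assumes "0 \<le> \<alpha>" "reg' \<alpha> c l 0 = 0 \<and> a = 1 \<or> reg \<alpha> c l 0 = 0 \<and> a = -1" "-1 < x" "x < 1"
  shows "reg \<alpha> c l (- x) = a * reg \<alpha> c l x" and "reg' \<alpha> c l (- x) = - a * reg' \<alpha> c l x"
proof -
  have "SL_solution (flux_coeff \<alpha>) (mass_coeff \<alpha> c l)
      (\<lambda>x. reg \<alpha> c l (- x) - a * reg \<alpha> c l x) (\<lambda>x. - reg' \<alpha> c l (- x) - a * reg' \<alpha> c l x)"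
    using SL_solution_reg[OF assms(1)] by (intro SL_solution_diff SL_solution_reflect) auto
  from flux_mass_unique[OF assms(1) this _ _ assms(3,4)] assms(2)
  show "reg \<alpha> c l (- x) = a * reg \<alpha> c l x" "reg' \<alpha> c l (- x) = - a * reg' \<alpha> c l x"
    by auto
qed

text \<open>
  Parity carries the behaviour at \<open>1\<close> over to \<open>-1\<close>.
\<close>

lemma regular_end_reg_left:
  assumes "0 \<le> \<alpha>" "reg \<alpha> c l 0 = 0 \<or> reg' \<alpha> c l 0 = 0"
  shows "regular_end (flux_coeff \<alpha>) (reg \<alpha> c l) (reg' \<alpha> c l) (at_right (-1))"
proof -
  obtain a :: real where a: "reg' \<alpha> c l 0 = 0 \<and> a = 1 \<or> reg \<alpha> c l 0 = 0 \<and> a = -1"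
    using assms(2) by blast
  then have a0: "a \<noteq> 0" by auto
  obtain A where A: "A \<noteq> 0" "(reg \<alpha> c l \<longlongrightarrow> A) (at_left 1)"
    "((\<lambda>x. flux_coeff \<alpha> x * reg' \<alpha> c l x) \<longlongrightarrow> 0) (at_left 1)"
    using regular_end_reg[OF assms(1), of c l] unfolding regular_end_def by blast
  have ev: "eventually (\<lambda>x :: real. x \<in> {-1<..<1}) (at_right (-1))"
    by (rule eventually_at_right_real) simp
  have "((\<lambda>x. a * reg \<alpha> c l (- x)) \<longlongrightarrow> a * A) (at_right (-1))"
    using A(2) by (intro tendsto_intros) (simp add: filterlim_at_left_to_right)
  moreover have "eventually (\<lambda>x. a * reg \<alpha> c l (- x) = reg \<alpha> c l x) (at_right (-1))"
    using ev by eventually_elim (use reg_parity(1)[OF assms(1) a] a in auto)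
  ultimately have 1: "(reg \<alpha> c l \<longlongrightarrow> a * A) (at_right (-1))"
    by (rule Lim_transform_eventually)
  have "((\<lambda>x. (- a) * (flux_coeff \<alpha> (- x) * reg' \<alpha> c l (- x))) \<longlongrightarrow> (- a) * 0) (at_right (-1))"
    using A(3) by (intro tendsto_intros) (simp add: filterlim_at_left_to_right)
  moreover have "eventually (\<lambda>x. (- a) * (flux_coeff \<alpha> (- x) * reg' \<alpha> c l (- x))
      = flux_coeff \<alpha> x * reg' \<alpha> c l x) (at_right (-1))"
    using ev by eventually_elim (use reg_parity(2)[OF assms(1) a] a in auto)
  ultimately have "((\<lambda>x. flux_coeff \<alpha> x * reg' \<alpha> c l x) \<longlongrightarrow> (- a) * 0) (at_right (-1))"
    by (rule Lim_transform_eventually)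
  with 1 show ?thesis
    unfolding regular_end_def using A(1) a0 by (auto intro!: exI[of _ "a * A"])
qed

lemma SL_eigenfunctionI:
  assumes "0 \<le> \<alpha>" and f: "SL_solution (flux_coeff \<alpha>) (mass_coeff \<alpha> c l) f f'"
    and cont: "continuous_on {-1..1} f" and nz: "-1 < x" "x < 1" "f x \<noteq> 0"
  shows "SL_eigenfunction \<alpha> c l f"
proof -
  have d: "deriv f t = f' t" if "-1 < t" "t < 1" for t
    using SL_solutionD(1)[OF f that] by (rule DERIV_imp_deriv)
  have flux: "((\<lambda>t. weight \<alpha> t * (1 - t\<^sup>2) * deriv f t) has_real_derivative
      - mass_coeff \<alpha> c l x * f x) (at x)" if "-1 < x" "x < 1" for x
    using SL_solutionD(2)[OF f that]
    by (rule has_field_derivative_transform_within_open[of _ _ _ "{-1<..<1}"])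
      (use that d in \<open>auto simp: flux_coeff_def\<close>)
  have bdd: "bounded (f ` {-1..1})"
    by (intro compact_imp_bounded compact_continuous_image cont) simp
  have "set_integrable lborel {-1..1} (\<lambda>x. (f x)\<^sup>2)"
    by (intro borel_integrable_atLeastAtMost' continuous_intros cont)
  then have int: "integrable lborel (\<lambda>x. indicat_real {-1..1} x * (f x)\<^sup>2)"
    by (simp add: set_integrable_def)
  have "integrable lborel (\<lambda>x. (indicat_real {-1..1} x * (f x)\<^sup>2) * weight \<alpha> x)"
  proof (rule Bochner_Integration.integrable_bound[OF int])
    show "(\<lambda>x. (indicat_real {-1..1} x * (f x)\<^sup>2) * weight \<alpha> x) \<in> borel_measurable lborel"
      using borel_measurable_integrable[OF int] unfolding weight_def by measurable
    show "AE x in lborel. norm ((indicat_real {-1..1} x * (f x)\<^sup>2) * weight \<alpha> x)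
        \<le> norm (indicat_real {-1..1} x * (f x)\<^sup>2)"
    proof (rule AE_I2)
      fix x :: real
      have "0 \<le> weight \<alpha> x" by (simp add: weight_def)
      then show "norm ((indicat_real {-1..1} x * (f x)\<^sup>2) * weight \<alpha> x)
        \<le> norm (indicat_real {-1..1} x * (f x)\<^sup>2)"
        using weight_le_1[OF assms(1), of x]
        by (auto simp: abs_mult indicator_def intro!: mult_left_le)
    qed
  qed
  then have "set_integrable lborel {-1..1} (\<lambda>x. (f x)\<^sup>2 * weight \<alpha> x)"
    by (simp add: set_integrable_def mult.assoc)
  moreover have "SL_op \<alpha> c f x = l * f x" if "-1 < x" "x < 1" for x
    using DERIV_imp_deriv[OF flux[OF that]] weight_pos[OF that, of \<alpha>]
    by (simp add: SL_op_def mass_coeff_def field_simps)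
  moreover have "f differentiable at x" "(\<lambda>t. weight \<alpha> t * (1 - t\<^sup>2) * deriv f t) differentiable at x"
    if "-1 < x" "x < 1" for x
    using SL_solutionD(1)[OF f that] flux[OF that] real_differentiable_def by blast+
  ultimately show ?thesis
    unfolding SL_eigenfunction_def using bdd nz by auto
qed

lemma SL_eigenfunctionD:
  assumes "SL_eigenfunction \<alpha> c l f"
  shows "SL_solution (flux_coeff \<alpha>) (mass_coeff \<alpha> c l) f (deriv f)"
  unfolding SL_solution_def
proof (intro ballI conjI)
  fix x :: real assume "x \<in> {-1<..<1}"
  then have x: "-1 < x" "x < 1" by auto
  show "(f has_real_derivative deriv f x) (at x)"
    using assms x unfolding SL_eigenfunction_def
    by (simp add: DERIV_deriv_iff_real_differentiable)
  let ?D = "deriv (\<lambda>t. weight \<alpha> t * (1 - t\<^sup>2) * deriv f t) x"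
  have "((\<lambda>t. weight \<alpha> t * (1 - t\<^sup>2) * deriv f t) has_real_derivative ?D) (at x)"
    using assms x unfolding SL_eigenfunction_def
    by (simp add: DERIV_deriv_iff_real_differentiable)
  moreover have "SL_op \<alpha> c f x = l * f x"
    using assms x unfolding SL_eigenfunction_def by auto
  then have "?D = - mass_coeff \<alpha> c l x * f x"
    using weight_pos[OF x, of \<alpha>] by (simp add: SL_op_def mass_coeff_def field_simps)
  ultimately show "((\<lambda>t. flux_coeff \<alpha> t * deriv f t) has_real_derivative - mass_coeff \<alpha> c l x * f x) (at x)"
    by (simp add: flux_coeff_def)
qed

text \<open>
  A bounded solution is proportional to \<open>reg\<close>. Otherwise the Wronskian \<open>w\<close>, which is constant, is
  nonzero, and \<open>(f / reg)' = w / (p reg\<^sup>2)\<close> is at least of the order of \<open>1 / (1 - x)\<close> near \<open>1\<close>, so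
  that \<open>f / reg\<close> grows like a logarithm.
\<close>

lemma bounded_solution_wronskian:
  assumes "0 \<le> \<alpha>" and f: "SL_solution (flux_coeff \<alpha>) (mass_coeff \<alpha> c l) f f'"
    and bdd: "bounded (f ` {-1..1})"
  shows "f' 0 * reg \<alpha> c l 0 = f 0 * reg' \<alpha> c l 0"
proof (rule ccontr)
  assume neq: "\<not> ?thesis"
  let ?g = "reg \<alpha> c l" and ?g' = "reg' \<alpha> c l" and ?p = "flux_coeff \<alpha>"
  note g = SL_solution_reg[OF assms(1), of c l]
  define W where "W x = (?p x * f' x) * ?g x - f x * (?p x * ?g' x)" for x
  define w where "w = W 0"
  have dW: "(W has_real_derivative 0) (at x)" if "-1 < x" "x < 1" for x
    unfolding W_def[abs_def]
    using DERIV_diff[OF DERIV_mult[OF SL_solutionD(2)[OF f that] SL_solutionD(1)[OF g that]]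
        DERIV_mult[OF SL_solutionD(1)[OF f that] SL_solutionD(2)[OF g that]]]
    by (simp add: algebra_simps)
  have Wconst: "W x = w" if "-1 < x" "x < 1" for x
    unfolding w_def by (rule DERIV_isconst3[of "-1" 1]) (use that dW in auto)
  have w0: "w \<noteq> 0" using neq by (simp add: w_def W_def)
  obtain K where K: "\<And>x. -1 \<le> x \<Longrightarrow> x \<le> 1 \<Longrightarrow> \<bar>f x\<bar> \<le> K"
    using bdd unfolding bounded_iff by force
  have "eventually (\<lambda>x. 1 / 2 < ?g x \<and> ?g x < 2) (at_left 1)"
    by (intro eventually_conj order_tendstoD[OF reg_tendsto_1[OF assms(1)]]) auto
  then obtain b where b: "b < 1" "\<And>x. b < x \<Longrightarrow> x < 1 \<Longrightarrow> 1 / 2 < ?g x \<and> ?g x < 2"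
    unfolding eventually_at_left_field by blast
  define a where "a = max 0 ((b + 1) / 2)"
  have a: "0 \<le> a" "b < a" "a < 1" using b(1) by (auto simp: a_def max_def)
  \<comment> \<open>Since \<open>p \<le> 2 (1 - t)\<close> and \<open>reg < 2\<close>, the derivative of \<open>f / reg\<close> is at least
    \<open>\<bar>w\<bar> / (8 (1 - t))\<close> in absolute value, which makes this function nondecreasing.\<close>
  define \<phi> where "\<phi> x = sgn w * (f x / ?g x) + \<bar>w\<bar> / 8 * ln (1 - x)" for x
  have mono: "\<phi> a \<le> \<phi> x" if x: "a \<le> x" "x < 1" for x
  proof (rule DERIV_nonneg_imp_nondecreasing[OF x(1)])
    fix t assume "a \<le> t" "t \<le> x"
    then have t: "-1 < t" "t < 1" "b < t" "0 \<le> t" using a x by auto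
    note gt = b(2)[OF t(3,2)]
    have "(\<phi> has_real_derivative sgn w * ((f' t * ?g t - f t * ?g' t) / (?g t * ?g t))
        + \<bar>w\<bar> / 8 * (1 / (1 - t) * - 1)) (at t)"
    proof -
      have "((\<lambda>t. ln (1 - t)) has_real_derivative 1 / (1 - t) * - 1) (at t)"
        using t by (auto intro!: derivative_eq_intros)
      moreover have "?g t \<noteq> 0" using gt by simp
      ultimately show ?thesis
        unfolding \<phi>_def[abs_def]
        by (intro DERIV_add DERIV_cmult DERIV_divide SL_solutionD(1)[OF f t(1,2)] SL_solutionD(1)[OF g t(1,2)])
    qed
    moreover have "0 \<le> sgn w * ((f' t * ?g t - f t * ?g' t) / (?g t * ?g t)) + \<bar>w\<bar> / 8 * (1 / (1 - t) * - 1)"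
    proof -
      have p: "0 < ?p t" using flux_coeff_pos t by simp
      have "f' t * ?g t - f t * ?g' t = w / ?p t"
        using Wconst[OF t(1,2)] p by (simp add: W_def field_simps)
      then have "sgn w * ((f' t * ?g t - f t * ?g' t) / (?g t * ?g t)) = \<bar>w\<bar> / (?p t * (?g t * ?g t))"
        by (simp add: abs_sgn mult.commute)
      moreover have "?p t * (?g t * ?g t) \<le> (2 * (1 - t)) * (2 * 2)"
      proof (intro mult_mono)
        have "?p t \<le> 1 - t\<^sup>2" using flux_coeff_le[OF assms(1)] t by simp
        also have "\<dots> = (1 + t) * (1 - t)" by (simp add: power2_eq_square algebra_simps)
        also have "\<dots> \<le> 2 * (1 - t)" using t by (intro mult_right_mono) auto
        finally show "?p t \<le> 2 * (1 - t)" .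
      qed (use gt t in auto)
      then have "\<bar>w\<bar> / (2 * (1 - t) * (2 * 2)) \<le> \<bar>w\<bar> / (?p t * (?g t * ?g t))"
        using p gt t by (intro divide_left_mono mult_pos_pos) auto
      ultimately show ?thesis by simp
    qed
    ultimately show "\<exists>y. (\<phi> has_real_derivative y) (at t) \<and> 0 \<le> y" by blast
  qed
  have bound: "\<bar>w\<bar> / 8 * - ln (1 - x) \<le> 2 * K - \<phi> a" if x: "a \<le> x" "a < x" "x < 1" for x
  proof -
    have gx: "1 / 2 < ?g x" using b(2) x a by auto
    have "\<bar>sgn w * (f x / ?g x)\<bar> = \<bar>f x\<bar> / ?g x"
      using w0 gx by (simp add: abs_mult abs_sgn_eq)
    also have "\<dots> \<le> K / (1 / 2)"
      using K[of x] gx x a by (intro frac_le) auto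
    finally have "\<bar>sgn w * (f x / ?g x)\<bar> \<le> 2 * K" by simp
    then have "sgn w * (f x / ?g x) \<le> 2 * K" by (rule order_trans[OF abs_ge_self])
    then show ?thesis using mono[OF x(1,3)] by (simp add: \<phi>_def)
  qed
  define N where "N = max (- ln (1 - a) + 1) ((2 * K - \<phi> a) * 8 / \<bar>w\<bar> + 1)"
  have N: "- ln (1 - a) < N" "(2 * K - \<phi> a) * 8 / \<bar>w\<bar> < N"
    by (simp_all add: N_def)
  have "exp (- N) < exp (ln (1 - a))"
    using N(1) by simp
  then have "a < 1 - exp (- N)" using a by simp
  then have "\<bar>w\<bar> / 8 * N \<le> 2 * K - \<phi> a"
    using bound[of "1 - exp (- N)"] by simp
  then show False
    using N(2) w0 by (simp add: field_simps)
qed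

lemma reg_nonzero:
  assumes "0 \<le> \<alpha>"
  shows "\<exists>x. 0 < x \<and> x < 1 \<and> reg \<alpha> c l x \<noteq> 0"
proof -
  have "eventually (\<lambda>x. 0 < reg \<alpha> c l x) (at_left 1)"
    by (rule order_tendstoD[OF reg_tendsto_1[OF assms]]) simp
  moreover have "eventually (\<lambda>x :: real. x \<in> {0<..<1}) (at_left 1)"
    by (rule eventually_at_left_real) simp
  ultimately have "eventually (\<lambda>x. 0 < x \<and> x < 1 \<and> reg \<alpha> c l x \<noteq> 0) (at_left 1)"
    by eventually_elim auto
  then show ?thesis
    using eventually_happens[of _ "at_left (1 :: real)"] by (auto simp: trivial_limit_at_left_real)
qed

text \<open>
  An eigenfunction \<open>f\<close> and its reflection are both bounded at \<open>1\<close>, hence both proportional to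
  \<open>reg\<close>. Comparing their data at \<open>0\<close> forces \<open>reg\<close> or its derivative to vanish there. Conversely,
  an even or odd \<open>reg\<close> is bounded at \<open>-1\<close> as well.
\<close>

theorem eigenvalue_iff:
  assumes "0 \<le> \<alpha>"
  shows "l \<in> SL_eigenvalues \<alpha> c \<longleftrightarrow> reg \<alpha> c l 0 = 0 \<or> reg' \<alpha> c l 0 = 0"
proof
  assume "l \<in> SL_eigenvalues \<alpha> c"
  then obtain f where f: "SL_eigenfunction \<alpha> c l f" by (auto simp: SL_eigenvalues_def)
  note sol = SL_eigenfunctionD[OF f]
  have bdd: "bounded (f ` {-1..1})" and nz: "\<exists>x\<in>{-1<..<1}. f x \<noteq> 0"
    using f by (auto simp: SL_eigenfunction_def)
  have "(\<lambda>x. f (- x)) ` {-1..1} = f ` {-1..1}"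
    using image_image[of f uminus "{-1..1 :: real}"] by simp
  then have "bounded ((\<lambda>x. f (- x)) ` {-1..1})" using bdd by simp
  from bounded_solution_wronskian[OF assms SL_solution_reflect[OF sol] this]
    bounded_solution_wronskian[OF assms sol bdd]
  have "deriv f 0 * reg \<alpha> c l 0 = 0" "f 0 * reg' \<alpha> c l 0 = 0" by auto
  moreover have "f 0 \<noteq> 0 \<or> deriv f 0 \<noteq> 0"
    using flux_mass_unique(1)[OF assms sol] nz by auto
  ultimately show "reg \<alpha> c l 0 = 0 \<or> reg' \<alpha> c l 0 = 0" by auto
next
  assume zero: "reg \<alpha> c l 0 = 0 \<or> reg' \<alpha> c l 0 = 0"
  then obtain a :: real where a: "reg' \<alpha> c l 0 = 0 \<and> a = 1 \<or> reg \<alpha> c l 0 = 0 \<and> a = -1"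
    by blast
  \<comment> \<open>The series defining \<open>reg\<close> need not converge at \<open>x = -1\<close>; \<open>F\<close> extends it continuously.\<close>
  define F where "F x = (if x \<le> 0 then a * reg \<alpha> c l (- x) else reg \<alpha> c l x)" for x
  have cont: "continuous_on {0..1} (reg \<alpha> c l)"
    by (rule DERIV_continuous_on[OF has_field_derivative_at_within[OF reg_has_derivative(1)[OF assms]]]) auto
  have "continuous_on {-1..1} F"
    unfolding F_def
    by (intro continuous_on_cases_le continuous_intros continuous_on_compose2[OF cont])
      (use a in auto)
  moreover have F: "F x = reg \<alpha> c l x" if "-1 < x" "x < 1" for x
    using reg_parity(1)[OF assms a that] a by (auto simp: F_def)
  have "SL_solution (flux_coeff \<alpha>) (mass_coeff \<alpha> c l) F (reg' \<alpha> c l)"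
    unfolding SL_solution_def
  proof (intro ballI conjI)
    fix x :: real assume "x \<in> {-1<..<1}"
    then have x: "-1 < x" "x < 1" by auto
    note r = SL_solutionD[OF SL_solution_reg[OF assms, of c l] x]
    show "(F has_real_derivative reg' \<alpha> c l x) (at x)"
      using r(1) by (rule has_field_derivative_transform_within_open[of _ _ _ "{-1<..<1}"])
        (use x F in auto)
    show "((\<lambda>t. flux_coeff \<alpha> t * reg' \<alpha> c l t) has_real_derivative - mass_coeff \<alpha> c l x * F x) (at x)"
      using r(2) F[OF x] by simp
  qed
  moreover have "\<exists>x. -1 < x \<and> x < 1 \<and> F x \<noteq> 0"
  proof -
    obtain x where "0 < x" "x < 1" "reg \<alpha> c l x \<noteq> 0"
      using reg_nonzero[OF assms] by blast
    then show ?thesis using F[of x] by (intro exI[of _ x]) simp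
  qed
  ultimately show "l \<in> SL_eigenvalues \<alpha> c"
    unfolding SL_eigenvalues_def using SL_eigenfunctionI[OF assms] by blast
qed

section \<open>The Pruefer angle\<close>

text \<open>
  Polar coordinates of the point \<open>(f, p f')\<close> along \<open>f = reg\<close>, followed from \<open>x = 1\<close>, where the angle
  is \<open>0\<close>, down to \<open>x = 0\<close>; the parameter is \<open>s = 1 - x\<close>.
\<close>

definition pruefer ::
  "real \<Rightarrow> real \<Rightarrow> real \<Rightarrow> (real \<Rightarrow> real) \<Rightarrow> (real \<Rightarrow> real) \<Rightarrow> bool" where
  "pruefer \<alpha> c l r \<theta> \<longleftrightarrow> continuous_on {0..1} \<theta> \<and> \<theta> 0 = 0 \<and>
     (\<forall>s\<in>{0..1}. 0 < r s \<and> reg \<alpha> c l (1 - s) = r s * cos (\<theta> s) \<and>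
        flux_coeff \<alpha> (1 - s) * reg' \<alpha> c l (1 - s) = r s * sin (\<theta> s))"

lemma prueferD:
  assumes "pruefer \<alpha> c l r \<theta>"
  shows "continuous_on {0..1} \<theta>" "\<theta> 0 = 0"
    and "\<And>s. 0 \<le> s \<Longrightarrow> s \<le> 1 \<Longrightarrow> 0 < r s"
    and "\<And>s. 0 \<le> s \<Longrightarrow> s \<le> 1 \<Longrightarrow> reg \<alpha> c l (1 - s) = r s * cos (\<theta> s)"
    and "\<And>s. 0 \<le> s \<Longrightarrow> s \<le> 1 \<Longrightarrow> flux_coeff \<alpha> (1 - s) * reg' \<alpha> c l (1 - s) = r s * sin (\<theta> s)"
  using assms by (auto simp: pruefer_def)

text \<open>
  A solution and its derivative do not vanish simultaneously, so \<open>reg + \<i> p reg'\<close> is a continuous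
  function without zeros on a rectangle in the \<open>(s, l)\<close>-plane. It has a continuous logarithm, whose
  imaginary part is the angle, jointly continuous in \<open>s\<close> and \<open>l\<close>.
\<close>

lemma pruefer_exists:
  assumes "0 \<le> \<alpha>" "0 \<le> B"
  shows "\<exists>r \<theta>. (\<forall>l\<in>{-B..B}. pruefer \<alpha> c l (r l) (\<theta> l)) \<and> continuous_on {-B..B} (\<lambda>l. \<theta> l 1)"
proof -
  let ?S = "{0..1} \<times> {-B..B} :: (real \<times> real) set"
  define z where "z = (\<lambda>(s, l). complex_of_real (reg \<alpha> c l (1 - s))
    + \<i> * complex_of_real (flux_coeff \<alpha> (1 - s) * reg' \<alpha> c l (1 - s)))"
  have Re_z: "Re (z (s, l)) = reg \<alpha> c l (1 - s)"
    and Im_z: "Im (z (s, l)) = flux_coeff \<alpha> (1 - s) * reg' \<alpha> c l (1 - s)" for s l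
    by (simp_all add: z_def)
  have c1: "continuous_on ?S (\<lambda>x. reg \<alpha> c (snd x) (1 - fst x))"
    and c2: "continuous_on ?S (\<lambda>x. reg' \<alpha> c (snd x) (1 - fst x))"
    using reg_jointly_continuous[OF assms, of c] by (simp_all add: case_prod_beta)
  have c3: "continuous_on ?S (\<lambda>x. flux_coeff \<alpha> (1 - fst x))"
    by (rule continuous_on_compose2[OF continuous_on_flux_coeff[OF assms(1)]])
      (auto intro!: continuous_intros)
  have "continuous_on ?S z"
    unfolding z_def case_prod_beta by (intro continuous_intros c1 c2 c3)
  moreover have "contractible ?S"
    by (intro convex_imp_contractible convex_Times) auto
  moreover have "z x \<noteq> 0" if x: "x \<in> ?S" for x
  proof
    assume z0: "z x = 0"
    obtain s l where sl: "x = (s, l)" "0 \<le> s" "s \<le> 1" using x by auto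
    have zero: "reg \<alpha> c l (1 - s) = 0" "flux_coeff \<alpha> (1 - s) * reg' \<alpha> c l (1 - s) = 0"
      using z0 Re_z[of s l] Im_z[of s l] sl by simp_all
    then have "s \<noteq> 0" by auto
    then have s: "-1 < 1 - s" "1 - s < 1" using sl by auto
    show False
      using reg_simple_zero[OF assms(1) s zero(1)] flux_coeff_pos[OF s, of \<alpha>] zero(2) by simp
  qed
  ultimately obtain g where g: "continuous_on ?S g" "\<And>x. x \<in> ?S \<Longrightarrow> z x = exp (g x)"
    using continuous_logarithm_on_contractible by metis
  \<comment> \<open>Normalised to vanish at \<open>s = 0\<close>; this is harmless, since \<open>z = 1\<close> there.\<close>
  define G where "G s l = g (s, l) - g (0, l)" for s l
  have expG: "exp (G s l) = z (s, l)" if "s \<in> {0..1}" "l \<in> {-B..B}" for s l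
  proof -
    have "z (0, l) = 1"
      by (simp add: z_def flux_coeff_def)
    then have "exp (g (0, l)) = 1" using g(2)[of "(0, l)"] that by simp
    then show ?thesis using g(2)[of "(s, l)"] that by (simp add: G_def exp_diff)
  qed
  define \<theta> where "\<theta> l s = Im (G s l)" for l s
  have "continuous_on ?S (\<lambda>x. g (fst x, snd x))" using g(1) by simp
  moreover have "continuous_on ?S (\<lambda>x. g (0, snd x))"
    by (rule continuous_on_compose2[OF g(1)]) (auto intro!: continuous_intros)
  ultimately have joint: "continuous_on ?S (\<lambda>x. \<theta> (snd x) (fst x))"
    unfolding G_def \<theta>_def by (intro continuous_intros)
  have pr: "pruefer \<alpha> c l (\<lambda>s. exp (Re (G s l))) (\<theta> l)" if l: "l \<in> {-B..B}" for l
    unfolding pruefer_def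
  proof (intro conjI ballI)
    have "continuous_on {0..1} (\<lambda>s. \<theta> (snd (s, l)) (fst (s, l)))"
      by (rule continuous_on_compose2[OF joint]) (use l in \<open>auto intro!: continuous_intros\<close>)
    then show "continuous_on {0..1} (\<theta> l)" by simp
    show "\<theta> l 0 = 0" by (simp add: G_def \<theta>_def)
    show "reg \<alpha> c l (1 - s) = exp (Re (G s l)) * cos (\<theta> l s)"
      "flux_coeff \<alpha> (1 - s) * reg' \<alpha> c l (1 - s) = exp (Re (G s l)) * sin (\<theta> l s)"
      if "s \<in> {0..1}" for s
      using Re_z[of s l] Im_z[of s l] expG[OF that l] unfolding \<theta>_def by (metis Re_exp, metis Im_exp)
  qed simp
  have "continuous_on {-B..B} (\<lambda>l. \<theta> (snd (1 :: real, l)) (fst (1 :: real, l)))"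
    by (rule continuous_on_compose2[where g = "\<lambda>x. \<theta> (snd x) (fst x)" and f = "\<lambda>l. (1, l)", OF joint])
      (auto intro!: continuous_intros)
  then have cont: "continuous_on {-B..B} (\<lambda>l. \<theta> l 1)" by simp
  show ?thesis
    by (rule exI[of _ "\<lambda>l s. exp (Re (G s l))"], rule exI[of _ \<theta>], intro conjI ballI pr cont)
qed

text \<open>
  If a function passes through a level only upwards, then it stays above the level once it has
  reached it.
\<close>

lemma level_not_recrossed:
  fixes \<theta> :: "real \<Rightarrow> real"
  assumes cont: "continuous_on {0..1} \<theta>"
    and up: "\<And>s. 0 < s \<Longrightarrow> s \<le> 1 \<Longrightarrow> \<theta> s = L \<Longrightarrow>
      \<exists>d>0. \<forall>t\<in>{0..1}. \<bar>t - s\<bar> < d \<longrightarrow> (t < s \<longrightarrow> \<theta> t < L) \<and> (s < t \<longrightarrow> L < \<theta> t)"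
    and 0: "\<theta> 0 \<noteq> L"
    and st: "0 \<le> s" "s < t" "t \<le> 1" "L \<le> \<theta> s"
  shows "L < \<theta> t"
proof -
  have weak: "L \<le> \<theta> u" if u: "s < u" "u \<le> 1" for u
  proof (rule ccontr)
    assume less: "\<not> L \<le> \<theta> u"
    define T where "T = {x \<in> {s..u}. L \<le> \<theta> x}"
    have cu: "continuous_on {s..u} \<theta>" using u st by (intro continuous_on_subset[OF cont]) auto
    have "closed T"
      unfolding T_def by (intro continuous_on_closed_Collect_le continuous_intros cu closed_atLeastAtMost)
    moreover have "bdd_above T" by (auto simp: T_def intro!: bdd_aboveI[of _ u])
    moreover have "s \<in> T" using st u by (simp add: T_def)
    then have "T \<noteq> {}" by blast
    ultimately have "Sup T \<in> T" by (intro closed_contains_Sup)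
    \<comment> \<open>The last point where the level is still attained; just after it the function must exceed
      the level again.\<close>
    define m where "m = Sup T"
    have m: "s \<le> m" "m \<le> u" "L \<le> \<theta> m" "m < u"
      using \<open>Sup T \<in> T\<close> less by (auto simp: m_def T_def less_le)
    have max: "x \<le> m" if "x \<in> T" for x
      unfolding m_def using that \<open>bdd_above T\<close> by (rule cSup_upper)
    have "\<theta> m = L"
    proof (rule ccontr)
      assume "\<theta> m \<noteq> L"
      moreover obtain x where "m \<le> x" "x \<le> u" "\<theta> x = L"
        using IVT2'[of \<theta> u L m] m less continuous_on_subset[OF cu, of "{m..u}"] by auto
      ultimately have "x \<in> T" "m < x" using m by (auto simp: T_def less_le)
      then show False using max by fastforce
    qed
    then have "0 < m" using m(1) st(1) 0 by (cases "m = 0") auto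
    then obtain d where d: "d > 0" "\<And>t. t \<in> {0..1} \<Longrightarrow> \<bar>t - m\<bar> < d \<Longrightarrow> m < t \<Longrightarrow> L < \<theta> t"
      using up[of m] m u \<open>\<theta> m = L\<close> by auto
    define t where "t = min (m + d / 2) u"
    have t: "m < t" "t \<le> u" "\<bar>t - m\<bar> < d" using d(1) m by (auto simp: t_def)
    then have "L < \<theta> t" using d(2)[of t] u \<open>0 < m\<close> by auto
    then show False using max[of t] t m by (auto simp: T_def)
  qed
  show ?thesis
  proof (rule ccontr)
    assume "\<not> ?thesis"
    then have "\<theta> t = L" using weak[of t] st by auto
    then obtain d where d: "d > 0" "\<And>x. x \<in> {0..1} \<Longrightarrow> \<bar>x - t\<bar> < d \<Longrightarrow> x < t \<Longrightarrow> \<theta> x < L"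
      using up[of t] st by auto
    define x where "x = max (t - d / 2) ((s + t) / 2)"
    have x: "s < x" "x < t" "\<bar>x - t\<bar> < d" using d(1) st by (auto simp: x_def abs_if max_def field_simps)
    then have "\<theta> x < L" using d(2)[of x] st by auto
    then show False using weak[of x] x st by auto
  qed
qed

text \<open>
  The zeros of \<open>cos \<circ> \<theta>\<close> are the points where \<open>\<theta>\<close> passes a level \<open>\<pi> / 2 + k \<pi>\<close>. Starting from \<open>0\<close>
  and crossing upwards only, \<open>\<theta>\<close> passes each level between \<open>0\<close> and \<open>\<theta> 1\<close> exactly once, and
  no other.
\<close>

lemma zeros_eq_levels:
  fixes \<theta> :: "real \<Rightarrow> real"
  assumes cont: "continuous_on {0..1} \<theta>" and 0: "\<theta> 0 = 0"
    and up: "\<And>s. 0 < s \<Longrightarrow> s \<le> 1 \<Longrightarrow> cos (\<theta> s) = 0 \<Longrightarrow>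
      \<exists>d>0. \<forall>t\<in>{0..1}. \<bar>t - s\<bar> < d \<longrightarrow> (t < s \<longrightarrow> \<theta> t < \<theta> s) \<and> (s < t \<longrightarrow> \<theta> s < \<theta> t)"
  shows "finite {s\<in>{0<..<1}. cos (\<theta> s) = 0}"
    and "card {s\<in>{0<..<1}. cos (\<theta> s) = 0} = card {k :: nat. pi / 2 + real k * pi < \<theta> 1}"
proof -
  define Z where "Z = {s\<in>{0<..<1}. cos (\<theta> s) = 0}"
  define K where "K = {k :: nat. pi / 2 + real k * pi < \<theta> 1}"
  define lev where "lev k = pi / 2 + real k * pi" for k :: nat
  have cos_lev: "cos (lev k) = 0" for k
    by (simp add: lev_def cos_add)
  have cross: "\<theta> s < \<theta> t" if "0 \<le> s" "s < t" "t \<le> 1" "cos (\<theta> s) = 0" for s t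
  proof (rule level_not_recrossed[OF cont, of "\<theta> s"])
    show "\<theta> 0 \<noteq> \<theta> s" using 0 that by auto
    show "\<exists>d>0. \<forall>t\<in>{0..1}. \<bar>t - u\<bar> < d \<longrightarrow> (t < u \<longrightarrow> \<theta> t < \<theta> s) \<and> (u < t \<longrightarrow> \<theta> s < \<theta> t)"
      if "0 < u" "u \<le> 1" "\<theta> u = \<theta> s" for u
      using up[of u] that \<open>cos (\<theta> s) = 0\<close> by simp
  qed (use that in auto)
  have inj: "inj_on \<theta> Z"
  proof (rule linorder_inj_onI')
    fix s t assume "s \<in> Z" "t \<in> Z" "s < t"
    then show "\<theta> s \<noteq> \<theta> t" using cross[of s t] by (simp add: Z_def)
  qed
  have "\<theta> ` Z = lev ` K"
  proof (intro equalityI subsetI)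
    fix y assume "y \<in> \<theta> ` Z"
    then obtain s where s: "0 < s" "s < 1" "cos (\<theta> s) = 0" and y: "y = \<theta> s"
      by (auto simp: Z_def)
    obtain i :: int where i: "\<theta> s = of_int i * pi + pi / 2"
      using s(3) by (auto simp: cos_zero_iff_int2)
    have "0 \<le> i"
    proof (rule ccontr)
      assume "\<not> 0 \<le> i"
      then have "i \<le> -1" by simp
      then have "of_int i * pi \<le> -1 * pi" by (intro mult_right_mono) auto
      then have neg: "\<theta> s < 0" using i pi_gt_zero by linarith
      have "\<theta> s < \<theta> s"
      proof (rule level_not_recrossed[OF cont, of "\<theta> s" 0])
        show "\<exists>d>0. \<forall>t\<in>{0..1}. \<bar>t - u\<bar> < d \<longrightarrow> (t < u \<longrightarrow> \<theta> t < \<theta> s) \<and> (u < t \<longrightarrow> \<theta> s < \<theta> t)"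
          if "0 < u" "u \<le> 1" "\<theta> u = \<theta> s" for u
          using up[of u] that s by simp
      qed (use s 0 neg in auto)
      then show False by simp
    qed
    then obtain k :: nat where "i = int k" using zero_le_imp_eq_int by blast
    then have lev: "\<theta> s = lev k" using i by (simp add: lev_def)
    moreover have "\<theta> s < \<theta> 1" using cross[of s 1] s by simp
    ultimately show "y \<in> lev ` K" using y by (auto simp: K_def lev_def)
  next
    fix y assume "y \<in> lev ` K"
    then obtain k where k: "y = lev k" "lev k < \<theta> 1" by (auto simp: K_def lev_def)
    have pos: "0 < lev k" by (simp add: lev_def add_pos_nonneg)
    obtain s where s: "0 \<le> s" "s \<le> 1" "\<theta> s = lev k"
      using IVT'[of \<theta> 0 "lev k" 1] pos k 0 cont by auto
    then have "s \<noteq> 0" "s \<noteq> 1" using pos 0 k by auto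
    then have "s \<in> Z" using s cos_lev by (auto simp: Z_def)
    then show "y \<in> \<theta> ` Z" using s k by (intro image_eqI[of _ _ s]) auto
  qed
  moreover have inj_lev: "inj_on lev K"
    by (auto simp: inj_on_def lev_def)
  ultimately have bij: "bij_betw \<theta> Z (lev ` K)" "bij_betw lev K (lev ` K)"
    using inj by (auto simp: bij_betw_def)
  have "finite K"
  proof (rule finite_subset)
    show "K \<subseteq> {..nat \<lceil>\<theta> 1\<rceil>}"
    proof
      fix k assume "k \<in> K"
      then have "pi / 2 + real k * pi < \<theta> 1" by (simp add: K_def)
      moreover have "real k * 1 \<le> real k * pi" using pi_gt3 by (intro mult_left_mono) auto
      ultimately have "real k \<le> \<theta> 1" using pi_gt_zero by linarith
      then have "real k \<le> of_int \<lceil>\<theta> 1\<rceil>" by linarith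
      then show "k \<in> {..nat \<lceil>\<theta> 1\<rceil>}" by simp
    qed
  qed simp
  then show "finite {s\<in>{0<..<1}. cos (\<theta> s) = 0}"
    using bij bij_betw_finite unfolding Z_def by blast
  show "card {s\<in>{0<..<1}. cos (\<theta> s) = 0} = card {k :: nat. pi / 2 + real k * pi < \<theta> 1}"
    using bij_betw_same_card[OF bij(1)] bij_betw_same_card[OF bij(2)] unfolding Z_def K_def by simp
qed

text \<open>
  At a zero of \<open>reg\<close> the sign of \<open>sin \<theta>\<close> is the sign of \<open>reg'\<close>, and therefore opposite to the
  direction in which \<open>reg\<close> changes with \<open>s = 1 - x\<close>.
\<close>

lemma pruefer_upcrossing:
  assumes "0 \<le> \<alpha>" and p: "pruefer \<alpha> c l r \<theta>"
    and s: "0 < s" "s \<le> 1" "cos (\<theta> s) = 0"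
  shows "\<exists>d>0. \<forall>t\<in>{0..1}. \<bar>t - s\<bar> < d \<longrightarrow> (t < s \<longrightarrow> \<theta> t < \<theta> s) \<and> (s < t \<longrightarrow> \<theta> s < \<theta> t)"
proof -
  note cont = prueferD(1)[OF p] and r = prueferD(3)[OF p]
    and cos = prueferD(4)[OF p] and sin = prueferD(5)[OF p]
  define \<sigma> where "\<sigma> = sin (\<theta> s)"
  have sq: "\<sigma> * \<sigma> = 1"
    using sin_cos_squared_add[of "\<theta> s"] s(3) by (simp add: \<sigma>_def power2_eq_square)
  have x: "-1 < 1 - s" "1 - s < 1" using s by auto
  \<comment> \<open>Decreasing at \<open>s\<close>, and a negative multiple of \<open>sin (\<theta> t - \<theta> s)\<close>.\<close>
  define h where "h t = \<sigma> * reg \<alpha> c l (1 - t)" for t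
  have "((\<lambda>t. reg \<alpha> c l (1 - t)) has_real_derivative reg' \<alpha> c l (1 - s) * - 1) (at s)"
    by (rule DERIV_chain2[where f = "reg \<alpha> c l" and g = "\<lambda>t. 1 - t", OF reg_has_derivative(1)[OF assms(1)]])
      (use s in \<open>auto intro!: derivative_eq_intros\<close>)
  then have dh: "(h has_real_derivative \<sigma> * (reg' \<alpha> c l (1 - s) * - 1)) (at s)"
    unfolding h_def[abs_def] by (rule DERIV_cmult)
  have "flux_coeff \<alpha> (1 - s) * (\<sigma> * reg' \<alpha> c l (1 - s)) = r s"
    using sin[of s] s sq by (simp add: \<sigma>_def mult.left_commute)
  then have "0 < flux_coeff \<alpha> (1 - s) * (\<sigma> * reg' \<alpha> c l (1 - s))"
    using r[of s] s by simp
  then have "0 < \<sigma> * reg' \<alpha> c l (1 - s)"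
    using flux_coeff_pos[OF x] by (rule zero_less_mult_pos)
  then have neg: "\<sigma> * (reg' \<alpha> c l (1 - s) * - 1) < 0" by simp
  obtain d1 where d1: "d1 > 0" "\<And>e. 0 < e \<Longrightarrow> e < d1 \<Longrightarrow> h (s + e) < h s"
    using DERIV_neg_dec_right[OF dh neg] by blast
  obtain d2 where d2: "d2 > 0" "\<And>e. 0 < e \<Longrightarrow> e < d2 \<Longrightarrow> h s < h (s - e)"
    using DERIV_neg_dec_left[OF dh neg] by blast
  obtain d3 where d3: "d3 > 0" "\<And>t. t \<in> {0..1} \<Longrightarrow> \<bar>t - s\<bar> < d3 \<Longrightarrow> \<bar>\<theta> t - \<theta> s\<bar> < pi"
    using cont[unfolded continuous_on_iff, rule_format, of s pi] s by (auto simp: dist_real_def)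
  have hs: "h s = 0" using cos[of s] s by (simp add: h_def)
  have h: "h t = - r t * sin (\<theta> t - \<theta> s)" if "t \<in> {0..1}" for t
  proof -
    have "cos (\<theta> t) = cos (\<theta> s + (\<theta> t - \<theta> s))" by simp
    also have "\<dots> = - \<sigma> * sin (\<theta> t - \<theta> s)"
      unfolding cos_add by (simp add: s(3) \<sigma>_def)
    finally show ?thesis
      using cos[of t] that sq by (simp add: h_def mult.left_commute)
  qed
  show ?thesis
  proof (intro exI[of _ "Min {d1, d2, d3}"] conjI ballI impI)
    show "0 < Min {d1, d2, d3}" using d1 d2 d3 by simp
    fix t :: real assume t: "t \<in> {0..1}" "\<bar>t - s\<bar> < Min {d1, d2, d3}"
    then have close: "\<bar>\<theta> t - \<theta> s\<bar> < pi" using d3 by simp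
    show "\<theta> t < \<theta> s" if "t < s"
    proof (rule ccontr)
      assume "\<not> \<theta> t < \<theta> s"
      then have "0 \<le> sin (\<theta> t - \<theta> s)" using close by (intro sin_ge_zero) auto
      then have "h t \<le> 0" using h[OF t(1)] r[of t] t(1) by simp
      moreover have "0 < h t" using d2(2)[of "s - t"] that t hs by auto
      ultimately show False by simp
    qed
    show "\<theta> s < \<theta> t" if "s < t"
    proof (rule ccontr)
      assume "\<not> \<theta> s < \<theta> t"
      then have "0 \<le> sin (- (\<theta> t - \<theta> s))" using close by (intro sin_ge_zero) auto
      then have "sin (\<theta> t - \<theta> s) \<le> 0" by (simp only: sin_minus)
      then have "0 \<le> h t" using h[OF t(1)] r[of t] t(1) by (simp add: mult_nonneg_nonpos)
      moreover have "h t < 0" using d1(2)[of "t - s"] that t hs by auto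
      ultimately show False by simp
    qed
  qed
qed

definition half_nodes :: "(real \<Rightarrow> real) \<Rightarrow> real set" where
  "half_nodes f = {x \<in> {0<..<1}. f x = 0}"

lemma half_nodes_reg:
  assumes "0 \<le> \<alpha>" and p: "pruefer \<alpha> c l r \<theta>"
  shows "finite (half_nodes (reg \<alpha> c l))"
    and "card (half_nodes (reg \<alpha> c l)) = card {k :: nat. pi / 2 + real k * pi < \<theta> 1}"
proof -
  note Z = zeros_eq_levels[OF prueferD(1,2)[OF p] pruefer_upcrossing[OF assms(1) p]]
  have eq: "half_nodes (reg \<alpha> c l) = (\<lambda>s. 1 - s) ` {s\<in>{0<..<1}. cos (\<theta> s) = 0}"
  proof (intro equalityI subsetI)
    fix x assume "x \<in> half_nodes (reg \<alpha> c l)"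
    then have x: "0 < x" "x < 1" "reg \<alpha> c l x = 0" by (auto simp: half_nodes_def)
    then have "cos (\<theta> (1 - x)) = 0" using prueferD(3,4)[OF p, of "1 - x"] by auto
    then show "x \<in> (\<lambda>s. 1 - s) ` {s\<in>{0<..<1}. cos (\<theta> s) = 0}"
      using x by (intro image_eqI[of _ _ "1 - x"]) auto
  qed (auto simp: half_nodes_def prueferD(4)[OF p])
  have inj: "inj_on (\<lambda>s. 1 - s) A" for A :: "real set"
    by (simp add: inj_on_def)
  show "finite (half_nodes (reg \<alpha> c l))" unfolding eq by (rule finite_imageI[OF Z(1)])
  show "card (half_nodes (reg \<alpha> c l)) = card {k :: nat. pi / 2 + real k * pi < \<theta> 1}"
    unfolding eq card_image[OF inj] by (rule Z(2))
qed

section \<open>Eigenvalues are numbered by zeros\<close>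

text \<open>
  Comparison with \<open>sin (K x)\<close> on \<open>[0, 1 / 2]\<close>, where the weight is bounded below. The coefficient
  \<open>p\<close> of the sine equation is \<open>1\<close>, which dominates the flux coefficient.
\<close>

lemma reg_many_half_nodes:
  assumes "0 \<le> \<alpha>"
  shows "\<exists>B\<ge>0. finite (half_nodes (reg \<alpha> c B)) \<longrightarrow> N \<le> card (half_nodes (reg \<alpha> c B))"
proof (cases "N = 0")
  case False
  then have N: "0 < N" by simp
  define K where "K = 2 * pi * real N"
  \<comment> \<open>Chosen so that \<open>(B - c\<^sup>2 x\<^sup>2) \<omega> \<ge> K\<^sup>2 + 1\<close> for \<open>0 \<le> x \<le> 1 / 2\<close>.\<close>
  define B where "B = c\<^sup>2 + (K\<^sup>2 + 1) / (3 / 4) powr \<alpha>"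
  have "0 \<le> B" unfolding B_def by (intro add_nonneg_nonneg divide_nonneg_nonneg) auto
  have K: "0 < K" using N by (simp add: K_def)
  define z where "z k = real k / (2 * real N)" for k :: nat
  have Kz: "K * z k = pi * real k" for k
    using N by (simp add: K_def z_def)
  have u: "SL_solution (\<lambda>_. 1) (\<lambda>_. K\<^sup>2) (\<lambda>x. sin (K * x)) (\<lambda>x. K * cos (K * x))"
    unfolding SL_solution_def
    by (auto intro!: derivative_eq_intros simp: power2_eq_square)
  note v = SL_solution_reg[OF assms, of c B]
  have "\<exists>x. z k < x \<and> x < z (Suc k) \<and> reg \<alpha> c B x = 0" if k: "k < N" for k
  proof (rule picone_zero_between[OF _ _ _ u v])
    have half: "z (Suc k) \<le> 1 / 2" using k N by (simp add: z_def field_simps)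
    show less: "z k < z (Suc k)" using N by (simp add: z_def divide_strict_right_mono)
    have z0: "0 \<le> z k" by (simp add: z_def)
    show "-1 \<le> z k" "z (Suc k) \<le> 1" using z0 half by auto
    show "0 < flux_coeff \<alpha> x \<and> flux_coeff \<alpha> x \<le> 1 \<and> K\<^sup>2 < mass_coeff \<alpha> c B x"
      if x: "z k < x" "x < z (Suc k)" for x
    proof (intro conjI)
      have x': "0 \<le> x" "x \<le> 1 / 2" using x z0 half by auto
      show "0 < flux_coeff \<alpha> x" using flux_coeff_pos x' by simp
      have "flux_coeff \<alpha> x \<le> 1 - x\<^sup>2" using flux_coeff_le[OF assms] x' by simp
      also have "\<dots> \<le> 1" by simp
      finally show "flux_coeff \<alpha> x \<le> 1" .
      have x2: "x\<^sup>2 \<le> (1 / 2)\<^sup>2" using x' by (intro power_mono) auto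
      then have w: "(3 / 4) powr \<alpha> \<le> weight \<alpha> x"
        unfolding weight_def using assms by (intro powr_mono2) (auto simp: power2_eq_square)
      have "c\<^sup>2 * x\<^sup>2 \<le> c\<^sup>2 * 1" using x2 by (intro mult_left_mono) (auto simp: power2_eq_square)
      then have "(K\<^sup>2 + 1) / (3 / 4) powr \<alpha> \<le> B - c\<^sup>2 * x\<^sup>2" by (simp add: B_def)
      then have "(K\<^sup>2 + 1) / (3 / 4) powr \<alpha> * (3 / 4) powr \<alpha> \<le> (B - c\<^sup>2 * x\<^sup>2) * weight \<alpha> x"
        using w by (intro mult_mono) (auto intro: order_trans[rotated] simp del: diff_ge_0_iff_ge)
      then show "K\<^sup>2 < mass_coeff \<alpha> c B x" by (simp add: mass_coeff_def)
    qed
    show "sin (K * x) \<noteq> 0" if x: "z k < x" "x < z (Suc k)" for x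
    proof
      assume "sin (K * x) = 0"
      then obtain i :: int where i: "K * x = of_int i * pi" by (auto simp: sin_zero_iff_int2)
      have "K * z k < K * x" "K * x < K * z (Suc k)" using x K by simp_all
      then have "pi * real k < pi * of_int i" "pi * of_int i < pi * (real k + 1)"
        using i Kz[of k] Kz[of "Suc k"] by (simp_all add: mult.commute)
      then have "real_of_int (int k) < of_int i" "of_int i < real_of_int (int k + 1)" by simp_all
      then show False unfolding of_int_less_iff by linarith
    qed
    have lim: "(picone (\<lambda>_. 1) (\<lambda>x. sin (K * x)) (\<lambda>x. K * cos (K * x))
        (flux_coeff \<alpha>) (reg \<alpha> c B) (reg' \<alpha> c B) \<longlongrightarrow> 0) (at (z j))" if "j \<le> N" for j
    proof (rule picone_tendsto_interior[OF u v])
      have "0 \<le> z j" "z j \<le> 1 / 2" using that N by (auto simp: z_def field_simps)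
      then show zj: "-1 < z j" "z j < 1" by auto
      show "sin (K * z j) = 0" unfolding Kz by (simp add: mult.commute)
      show "reg' \<alpha> c B (z j) \<noteq> 0" if "reg \<alpha> c B (z j) = 0"
        using reg_simple_zero[OF assms zj that] .
    qed
    show "(picone (\<lambda>_. 1) (\<lambda>x. sin (K * x)) (\<lambda>x. K * cos (K * x))
        (flux_coeff \<alpha>) (reg \<alpha> c B) (reg' \<alpha> c B) \<longlongrightarrow> 0) (at_right (z k))"
      by (rule tendsto_within_subset[OF lim]) (use k in auto)
    show "(picone (\<lambda>_. 1) (\<lambda>x. sin (K * x)) (\<lambda>x. K * cos (K * x))
        (flux_coeff \<alpha>) (reg \<alpha> c B) (reg' \<alpha> c B) \<longlongrightarrow> 0) (at_left (z (Suc k)))"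
      by (rule tendsto_within_subset[OF lim]) (use k in auto)
  qed
  then obtain g where g: "z k < g k" "g k < z (Suc k)" "reg \<alpha> c B (g k) = 0" if "k < N" for k
    by metis
  have "inj_on g {..<N}"
  proof (rule linorder_inj_onI')
    fix i j assume ij: "i \<in> {..<N}" "j \<in> {..<N}" "i < j"
    then have "z (Suc i) \<le> z j" using N by (simp add: z_def divide_right_mono)
    then show "g i \<noteq> g j" using g(2)[of i] g(1)[of j] ij by auto
  qed
  moreover have "g ` {..<N} \<subseteq> half_nodes (reg \<alpha> c B)"
  proof
    fix x assume "x \<in> g ` {..<N}"
    then obtain k where k: "k < N" "x = g k" by auto
    have "0 \<le> z k" "z (Suc k) \<le> 1 / 2" using k N by (auto simp: z_def field_simps)
    then show "x \<in> half_nodes (reg \<alpha> c B)" using g[OF k(1)] k(2) by (auto simp: half_nodes_def)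
  qed
  ultimately have "finite (half_nodes (reg \<alpha> c B)) \<longrightarrow> N \<le> card (half_nodes (reg \<alpha> c B))"
    using card_inj_on_le[of g "{..<N}"] by auto
  then show ?thesis using \<open>0 \<le> B\<close> by blast
qed auto

text \<open>
  For \<open>l = 0\<close> the product \<open>f (p f')\<close> has derivative \<open>p f'\<^sup>2 + c\<^sup>2 x\<^sup>2 \<omega> f\<^sup>2 \<ge> 0\<close> and tends to \<open>0\<close> at
  \<open>1\<close>. It gives the starting value for the intermediate value argument in \<open>l\<close>.
\<close>

lemma reg_0_flux_sign:
  assumes "0 \<le> \<alpha>" "0 \<le> x" "x < 1"
  shows "reg \<alpha> c 0 x * (flux_coeff \<alpha> x * reg' \<alpha> c 0 x) \<le> 0"
proof -
  let ?g = "\<lambda>x. reg \<alpha> c 0 x * (flux_coeff \<alpha> x * reg' \<alpha> c 0 x)"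
  note sol = SL_solution_reg[OF assms(1), of c 0]
  have mono: "?g x \<le> ?g y" if y: "x < y" "y < 1" for y
  proof (rule DERIV_nonneg_imp_nondecreasing[OF less_imp_le[OF y(1)]])
    fix t assume "x \<le> t" "t \<le> y"
    then have t: "-1 < t" "t < 1" using assms y by auto
    have "(?g has_real_derivative reg' \<alpha> c 0 t * (flux_coeff \<alpha> t * reg' \<alpha> c 0 t)
        + - mass_coeff \<alpha> c 0 t * reg \<alpha> c 0 t * reg \<alpha> c 0 t) (at t)"
      by (rule DERIV_mult[OF SL_solutionD(1,2)[OF sol t]])
    moreover have "reg' \<alpha> c 0 t * (flux_coeff \<alpha> t * reg' \<alpha> c 0 t) = flux_coeff \<alpha> t * (reg' \<alpha> c 0 t)\<^sup>2"
      "- mass_coeff \<alpha> c 0 t * reg \<alpha> c 0 t * reg \<alpha> c 0 t = c\<^sup>2 * t\<^sup>2 * weight \<alpha> t * (reg \<alpha> c 0 t)\<^sup>2"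
      by (simp_all add: mass_coeff_def power2_eq_square)
    moreover have "0 \<le> flux_coeff \<alpha> t * (reg' \<alpha> c 0 t)\<^sup>2" "0 \<le> c\<^sup>2 * t\<^sup>2 * weight \<alpha> t * (reg \<alpha> c 0 t)\<^sup>2"
      using flux_coeff_pos[OF t, of \<alpha>] weight_pos[OF t, of \<alpha>] by simp_all
    ultimately show "\<exists>D. (?g has_real_derivative D) (at t) \<and> 0 \<le> D"
      by (metis add_nonneg_nonneg)
  qed
  obtain A where "(reg \<alpha> c 0 \<longlongrightarrow> A) (at_left 1)"
    "((\<lambda>x. flux_coeff \<alpha> x * reg' \<alpha> c 0 x) \<longlongrightarrow> 0) (at_left 1)"
    using regular_end_reg[OF assms(1)] unfolding regular_end_def by blast
  from tendsto_mult[OF this] have "(?g \<longlongrightarrow> 0) (at_left 1)" by simp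
  then show ?thesis
    by (rule tendsto_lowerbound)
      (auto intro!: eventually_mono[OF eventually_at_left_real[OF assms(3)]] mono)
qed

lemma card_nodes_reg:
  assumes "0 \<le> \<alpha>" "reg \<alpha> c l 0 = 0 \<or> reg' \<alpha> c l 0 = 0" "finite (half_nodes (reg \<alpha> c l))"
  shows "finite (nodes (reg \<alpha> c l))"
    and "card (nodes (reg \<alpha> c l)) = 2 * card (half_nodes (reg \<alpha> c l)) + (if reg \<alpha> c l 0 = 0 then 1 else 0)"
proof -
  let ?H = "half_nodes (reg \<alpha> c l)" and ?Z = "{x :: real. x = 0 \<and> reg \<alpha> c l x = 0}"
  obtain a :: real where a: "reg' \<alpha> c l 0 = 0 \<and> a = 1 \<or> reg \<alpha> c l 0 = 0 \<and> a = -1"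
    using assms(2) by blast
  then have a0: "a \<noteq> 0" by auto
  have sym: "reg \<alpha> c l (- x) = 0 \<longleftrightarrow> reg \<alpha> c l x = 0" if "-1 < x" "x < 1" for x
    using reg_parity(1)[OF assms(1) a that] a0 by simp
  have eq: "nodes (reg \<alpha> c l) = (?H \<union> uminus ` ?H) \<union> ?Z"
  proof (intro equalityI subsetI)
    fix x assume "x \<in> nodes (reg \<alpha> c l)"
    then have x: "-1 < x" "x < 1" "reg \<alpha> c l x = 0" by (auto simp: nodes_def)
    consider "0 < x" | "x = 0" | "x < 0" by linarith
    then show "x \<in> (?H \<union> uminus ` ?H) \<union> ?Z"
    proof cases
      case 3
      then have "- x \<in> ?H" using x sym[of x] by (auto simp: half_nodes_def)
      then have "x \<in> uminus ` ?H" by (rule rev_image_eqI) simp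
      then show ?thesis by blast
    qed (use x in \<open>auto simp: half_nodes_def\<close>)
  qed (auto simp: half_nodes_def nodes_def sym)
  have fin: "finite ?Z" by (rule finite_subset[of _ "{0}"]) auto
  then show "finite (nodes (reg \<alpha> c l))" unfolding eq using assms(3) by simp
  have "card (nodes (reg \<alpha> c l)) = card (?H \<union> uminus ` ?H) + card ?Z"
    unfolding eq using assms(3) fin by (intro card_Un_disjoint) (auto simp: half_nodes_def)
  also have "card (?H \<union> uminus ` ?H) = card ?H + card (uminus ` ?H)"
    using assms(3) by (intro card_Un_disjoint) (auto simp: half_nodes_def)
  also have "card (uminus ` ?H) = card ?H"
    by (rule card_image) (auto simp: inj_on_def)
  also have "?Z = (if reg \<alpha> c l 0 = 0 then {0} else {})" by auto
  finally show "card (nodes (reg \<alpha> c l)) = 2 * card ?H + (if reg \<alpha> c l 0 = 0 then 1 else 0)"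
    by simp
qed

lemma eigenvalue_finite_nodes:
  assumes "0 \<le> \<alpha>" "l \<in> SL_eigenvalues \<alpha> c"
  shows "finite (nodes (reg \<alpha> c l))"
proof -
  obtain r \<theta> where "\<forall>m\<in>{-\<bar>l\<bar>..\<bar>l\<bar>}. pruefer \<alpha> c m (r m) (\<theta> m)"
    using pruefer_exists[OF assms(1) abs_ge_zero] by blast
  moreover have "l \<in> {-\<bar>l\<bar>..\<bar>l\<bar>}" by (simp add: abs_if)
  ultimately have "pruefer \<alpha> c l (r l) (\<theta> l)" by blast
  then have "finite (half_nodes (reg \<alpha> c l))"
    by (rule half_nodes_reg(1)[OF assms(1)])
  then show ?thesis
    using card_nodes_reg(1)[OF assms(1)] assms(2) eigenvalue_iff[OF assms(1)] by blast
qed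

text \<open>
  The eigenvalues are the parameters for which the Pruefer angle at \<open>x = 0\<close> is a multiple
  \<open>n \<pi> / 2\<close>: even \<open>n\<close> means \<open>reg' 0 = 0\<close>, odd \<open>n\<close> means \<open>reg 0 = 0\<close>. The angle then has passed
  \<open>n div 2\<close> levels \<open>\<pi> / 2 + k \<pi>\<close>, which accounts for \<open>n\<close> zeros in \<open>(-1, 1)\<close> after reflection.
\<close>

theorem eigenvalue_with_nodes:
  assumes "0 \<le> \<alpha>"
  shows "\<exists>l\<in>SL_eigenvalues \<alpha> c. card (nodes (reg \<alpha> c l)) = n"
proof -
  obtain B where B: "0 \<le> B"
    "finite (half_nodes (reg \<alpha> c B)) \<Longrightarrow> n + 1 \<le> card (half_nodes (reg \<alpha> c B))"
    using reg_many_half_nodes[OF assms] by blast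
  obtain r \<theta> where ball: "\<forall>l\<in>{-B..B}. pruefer \<alpha> c l (r l) (\<theta> l)"
    and cont: "continuous_on {-B..B} (\<lambda>l. \<theta> l 1)"
    using pruefer_exists[OF assms B(1)] by blast
  note p = bspec[OF ball]
  note half = half_nodes_reg[OF assms p]
  have low: "\<theta> 0 1 \<le> 0"
  proof (rule ccontr)
    assume "\<not> \<theta> 0 1 \<le> 0"
    then have pos: "0 < \<theta> 0 1" by simp
    \<comment> \<open>An angle inside the first quadrant, where \<open>reg\<close> and \<open>reg'\<close> would have the same sign.\<close>
    define y where "y = min (\<theta> 0 1) (pi / 4)"
    have "y \<le> pi / 4" unfolding y_def by (rule min.cobounded2)
    then have "y < pi / 2" using pi_gt_zero by linarith
    moreover have "0 < y" "y \<le> \<theta> 0 1" using pos by (simp_all add: y_def)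
    ultimately have y: "0 < y" "y \<le> \<theta> 0 1" "y < pi / 2" by blast+
    have "0 \<in> {-B..B}" using B(1) by simp
    note P = prueferD[OF p[OF this]]
    obtain s where s: "0 \<le> s" "s \<le> 1" "\<theta> 0 s = y"
      using IVT'[of "\<theta> 0" 0 y 1, OF _ y(2) _ P(1)] y(1) P(2) by (metis less_imp_le zero_le_one)
    then have "s \<noteq> 0" using y P(2) by auto
    have "0 < sin y" "0 < cos y" using y by (auto intro!: sin_gt_zero cos_gt_zero)
    moreover have "0 < r 0 s" using P(3)[OF s(1,2)] .
    ultimately have "0 < (r 0 s * cos y) * (r 0 s * sin y)" by simp
    moreover have "(r 0 s * cos y) * (r 0 s * sin y) \<le> 0"
      using reg_0_flux_sign[OF assms, of "1 - s" c] P(4,5)[OF s(1,2)] s \<open>s \<noteq> 0\<close> by simp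
    ultimately show False by simp
  qed
  have high: "real n * (pi / 2) \<le> \<theta> B 1"
  proof -
    let ?K = "{k :: nat. pi / 2 + real k * pi < \<theta> B 1}"
    have "n + 1 \<le> card ?K" using half[of B] B by simp
    have "n \<in> ?K"
    proof (rule ccontr)
      assume n: "n \<notin> ?K"
      have "?K \<subseteq> {..<n}"
      proof
        fix k assume k: "k \<in> ?K"
        show "k \<in> {..<n}"
        proof (rule ccontr)
          assume "k \<notin> {..<n}"
          then have "real n * pi \<le> real k * pi" by (intro mult_right_mono) auto
          moreover have "\<not> pi / 2 + real n * pi < \<theta> B 1" "pi / 2 + real k * pi < \<theta> B 1"
            using n k by simp_all
          ultimately show False by linarith
        qed
      qed
      then have "card ?K \<le> n" using card_mono[of "{..<n}" ?K] by simp
      then show False using \<open>n + 1 \<le> card ?K\<close> by simp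
    qed
    then have "pi / 2 + real n * pi < \<theta> B 1" by simp
    moreover have "real n * (pi / 2) \<le> real n * pi" by (intro mult_left_mono) simp_all
    ultimately show ?thesis using pi_gt_zero by linarith
  qed
  obtain l where l: "0 \<le> l" "l \<le> B" "\<theta> l 1 = real n * (pi / 2)"
  proof -
    have "\<theta> 0 1 \<le> real n * (pi / 2)" using low by (rule order_trans) simp
    moreover have "continuous_on {0..B} (\<lambda>l. \<theta> l 1)"
      by (rule continuous_on_subset[OF cont]) (use B(1) in auto)
    ultimately show ?thesis
      using IVT'[of "\<lambda>l. \<theta> l 1" 0 "real n * (pi / 2)" B] high B(1) that by blast
  qed
  then have lB: "l \<in> {-B..B}" by auto
  have "{k :: nat. pi / 2 + real k * pi < real n * (pi / 2)} = {..<n div 2}"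
  proof -
    have "pi / 2 + real k * pi < real n * (pi / 2) \<longleftrightarrow> k < n div 2" for k
    proof -
      have "pi / 2 + real k * pi < real n * (pi / 2) \<longleftrightarrow> real (1 + 2 * k) * (pi / 2) < real n * (pi / 2)"
        by (simp add: algebra_simps)
      also have "\<dots> \<longleftrightarrow> 1 + 2 * k < n"
        by (subst mult_less_cancel_right_pos) auto
      also have "\<dots> \<longleftrightarrow> k < n div 2" by presburger
      finally show ?thesis .
    qed
    then show ?thesis by auto
  qed
  then have H: "card (half_nodes (reg \<alpha> c l)) = n div 2" "finite (half_nodes (reg \<alpha> c l))"
    using half[OF lB] l by auto
  have g: "reg \<alpha> c l 0 = r l 1 * cos (real n * (pi / 2))" "reg' \<alpha> c l 0 = r l 1 * sin (real n * (pi / 2))"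
    using prueferD(4,5)[OF p[OF lB], of 1] l(3) by simp_all
  have r: "r l 1 \<noteq> 0" using prueferD(3)[OF p[OF lB], of 1] by simp
  show ?thesis
  proof (cases "even n")
    case True
    then obtain j where j: "n = 2 * j" by blast
    have "sin (real n * (pi / 2)) = 0" by (simp add: j)
    then have g0: "reg' \<alpha> c l 0 = 0" using g by simp
    then have "reg \<alpha> c l 0 \<noteq> 0" using reg_simple_zero[OF assms, of 0 c l] by auto
    then have "card (nodes (reg \<alpha> c l)) = n"
      using card_nodes_reg(2)[OF assms disjI2[OF g0] H(2)] H(1) True by simp
    then show ?thesis using eigenvalue_iff[OF assms] g0 by blast
  next
    case False
    then obtain j where j: "n = 2 * j + 1" by (rule oddE)
    have "real n * (pi / 2) = real j * pi + pi / 2"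
      by (simp add: j field_simps)
    then have "cos (real n * (pi / 2)) = 0"
      by (simp only: cos_add) simp
    then have g0: "reg \<alpha> c l 0 = 0" using g by simp
    then have "card (nodes (reg \<alpha> c l)) = n"
      using card_nodes_reg(2)[OF assms disjI1[OF g0] H(2)] H(1) j by simp
    then show ?thesis using eigenvalue_iff[OF assms] g0 by blast
  qed
qed

lemma nodes_strict_mono:
  assumes "0 \<le> \<alpha>" "l \<in> SL_eigenvalues \<alpha> c" "m \<in> SL_eigenvalues \<alpha> d"
    and coeff: "\<And>x. -1 < x \<Longrightarrow> x < 1 \<Longrightarrow> l - c\<^sup>2 * x\<^sup>2 < m - d\<^sup>2 * x\<^sup>2"
  shows "card (nodes (reg \<alpha> c l)) < card (nodes (reg \<alpha> d m))"
proof (rule sturm_comparison[OF SL_solution_reg SL_solution_reg])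
  show "0 < flux_coeff \<alpha> x \<and> flux_coeff \<alpha> x \<le> flux_coeff \<alpha> x \<and> mass_coeff \<alpha> c l x < mass_coeff \<alpha> d m x"
    if "-1 < x" "x < 1" for x
    using that coeff flux_coeff_pos weight_pos by (simp add: mass_coeff_def)
qed (use assms(1-3) eigenvalue_iff[OF assms(1)] in \<open>auto intro: regular_end_reg regular_end_reg_left
      eigenvalue_finite_nodes dest: reg_simple_zero\<close>)

text \<open>
  Counting zeros is a strictly increasing bijection from the eigenvalues onto the natural numbers.
\<close>

theorem chi_nodes:
  assumes "0 \<le> \<alpha>"
  shows "chi \<alpha> c n \<in> SL_eigenvalues \<alpha> c" and "card (nodes (reg \<alpha> c (chi \<alpha> c n))) = n"
proof -
  let ?N = "\<lambda>l. card (nodes (reg \<alpha> c l))" and ?E = "SL_eigenvalues \<alpha> c"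
  obtain l where l: "l \<in> ?E" "?N l = n" using eigenvalue_with_nodes[OF assms] by blast
  have mono: "?N a < ?N b" if "a \<in> ?E" "b \<in> ?E" "a < b" for a b
    using nodes_strict_mono[OF assms that(1,2)] that(3) by simp
  have inj: "inj_on ?N {m \<in> ?E. m < l}"
    by (rule linorder_inj_onI') (use mono in \<open>auto simp: less_imp_neq\<close>)
  have img: "?N ` {m \<in> ?E. m < l} = {..<n}"
  proof (intro equalityI subsetI)
    fix k assume "k \<in> {..<n}"
    obtain m where m: "m \<in> ?E" "?N m = k" using eigenvalue_with_nodes[OF assms] by blast
    have "m < l" using mono[of l m] l m \<open>k \<in> {..<n}\<close> by (cases l m rule: linorder_cases) auto
    then show "k \<in> ?N ` {m \<in> ?E. m < l}" using m by auto
  qed (use mono l in auto)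
  have "finite {m \<in> ?E. m < l}" using finite_imageD[OF _ inj] img by simp
  moreover have "card {m \<in> ?E. m < l} = n" using card_image[OF inj] img by simp
  ultimately have "chi \<alpha> c n = l" using l(1) by (intro chi_eqI)
  then show "chi \<alpha> c n \<in> ?E" "?N (chi \<alpha> c n) = n" using l by auto
qed

section \<open>Comparison with Gegenbauer polynomials\<close>

definition gegenbauer_eigenvalue :: "real \<Rightarrow> nat \<Rightarrow> real" where
  "gegenbauer_eigenvalue \<alpha> n = real n * (real n + 2 * \<alpha> + 1)"

text \<open>
  For \<open>c = 0\<close> the recurrence of \<open>frob\<close> has only one term, and its factor vanishes at \<open>k = n\<close>.
\<close>

lemma reg_gegenbauer:
  "reg \<alpha> 0 (gegenbauer_eigenvalue \<alpha> n) x
     = (\<Sum>k\<le>n. frob \<alpha> 0 (gegenbauer_eigenvalue \<alpha> n) (k + 2) * (1 - x) ^ k)"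
proof -
  let ?a = "\<lambda>k. frob \<alpha> 0 (gegenbauer_eigenvalue \<alpha> n) (k + 2)"
  have rec: "?a (Suc k) = (real k * (real k + 2 * \<alpha> + 1) - gegenbauer_eigenvalue \<alpha> n)
      / (2 * (real k + 1) * (real k + 1 + \<alpha>)) * ?a k" for k
    by (simp add: numeral_2_eq_2)
  have "?a (Suc n + j) = 0" for j
  proof (induction j)
    case 0
    show ?case unfolding add_0_right rec by (simp add: gegenbauer_eigenvalue_def)
  next
    case (Suc j)
    then show ?case unfolding add_Suc_right rec[of "Suc n + j"] by (simp only: mult_zero_right)
  qed
  then have "?a k = 0" if "k \<notin> {..n}" for k
    using that le_Suc_ex[of "Suc n" k] by auto
  then show ?thesis
    unfolding reg_def eval_fps_def reg_fps_def fps_nth_Abs_fps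
    by (intro suminf_finite) auto
qed

lemma gegenbauer_eigenvalue_in:
  assumes "0 \<le> \<alpha>"
  shows "gegenbauer_eigenvalue \<alpha> n \<in> SL_eigenvalues \<alpha> 0"
proof -
  let ?l = "gegenbauer_eigenvalue \<alpha> n"
  have "continuous_on {-1..1} (reg \<alpha> 0 ?l)"
    unfolding reg_gegenbauer[abs_def] by (intro continuous_intros)
  moreover obtain x where "0 < x" "x < 1" "reg \<alpha> 0 ?l x \<noteq> 0"
    using reg_nonzero[OF assms] by blast
  ultimately have "SL_eigenfunction \<alpha> 0 ?l (reg \<alpha> 0 ?l)"
    by (intro SL_eigenfunctionI[OF assms SL_solution_reg[OF assms], where x = x]) auto
  then show ?thesis by (auto simp: SL_eigenvalues_def)
qed

text \<open>
  The degree bounds the number of zeros from above. The number of zeros increases strictly with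
  \<open>n\<close>, which bounds it from below.
\<close>

lemma card_nodes_gegenbauer:
  assumes "0 \<le> \<alpha>"
  shows "card (nodes (reg \<alpha> 0 (gegenbauer_eigenvalue \<alpha> n))) = n"
proof (rule antisym)
  let ?g = "\<lambda>n. reg \<alpha> 0 (gegenbauer_eigenvalue \<alpha> n)"
  let ?a = "\<lambda>k. frob \<alpha> 0 (gegenbauer_eigenvalue \<alpha> n) (k + 2)"
  let ?Z = "{s. (\<Sum>k\<le>n. ?a k * s ^ k) = 0}"
  have "?a 0 \<noteq> 0" by (simp add: numeral_2_eq_2)
  then have Z: "finite ?Z" "card ?Z \<le> n"
    using Transcendental.polyfun_rootbound[of ?a 0 n] by blast+
  have "nodes (?g n) \<subseteq> (\<lambda>s. 1 - s) ` ?Z"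
  proof
    fix x assume "x \<in> nodes (?g n)"
    then have "1 - x \<in> ?Z" by (simp add: nodes_def reg_gegenbauer)
    then show "x \<in> (\<lambda>s. 1 - s) ` ?Z" by (rule rev_image_eqI) simp
  qed
  then have "card (nodes (?g n)) \<le> card ?Z"
    using Z(1) by (rule surj_card_le[rotated])
  then show "card (nodes (?g n)) \<le> n" using Z(2) by simp
  show "n \<le> card (nodes (?g n))"
  proof (induction n)
    case (Suc n)
    have "real n * (real n + 2 * \<alpha> + 1) < real (Suc n) * (real (Suc n) + 2 * \<alpha> + 1)"
      using assms by (intro mult_strict_mono) auto
    then have "card (nodes (?g n)) < card (nodes (?g (Suc n)))"
      by (intro nodes_strict_mono assms gegenbauer_eigenvalue_in) (simp add: gegenbauer_eigenvalue_def)
    then show ?case using Suc by simp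
  qed simp
qed

theorem chi_upper_bound:
  assumes "0 \<le> \<alpha>"
  shows "chi \<alpha> c n \<le> gegenbauer_eigenvalue \<alpha> n + c\<^sup>2"
proof (rule ccontr)
  assume "\<not> ?thesis"
  then have less: "gegenbauer_eigenvalue \<alpha> n + c\<^sup>2 < chi \<alpha> c n" by simp
  have "card (nodes (reg \<alpha> 0 (gegenbauer_eigenvalue \<alpha> n))) < card (nodes (reg \<alpha> c (chi \<alpha> c n)))"
  proof (rule nodes_strict_mono[OF assms gegenbauer_eigenvalue_in[OF assms] chi_nodes(1)[OF assms]])
    fix x :: real assume "-1 < x" "x < 1"
    then have "c\<^sup>2 * x\<^sup>2 \<le> c\<^sup>2 * 1"
      using one_minus_square_pos[of x] by (intro mult_left_mono) auto
    then show "gegenbauer_eigenvalue \<alpha> n - 0\<^sup>2 * x\<^sup>2 < chi \<alpha> c n - c\<^sup>2 * x\<^sup>2"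
      using less by simp
  qed
  then show False using chi_nodes(2)[OF assms] card_nodes_gegenbauer[OF assms] by simp
qed

text \<open>
  If \<open>g\<close> solves \<open>(p g')' = - m \<omega> g\<close>, then \<open>v = g \<circ> h\<close> solves \<open>(r v')' = - s v\<close> with
  \<open>r = p(h) / h'\<close> and \<open>s = m \<omega>(h) h'\<close>, because \<open>r v' = (p g')(h)\<close>. The two inequalities on the
  coefficients are those of Sturm-Picone comparison, and \<open>h\<close> maps the zeros of \<open>v\<close> injectively to
  zeros of \<open>g\<close>.
\<close>

lemma nodes_less_transplanted:
  assumes "0 \<le> \<alpha>" "l \<in> SL_eigenvalues \<alpha> c" "m \<in> SL_eigenvalues \<alpha> 0"
    and h: "\<And>x. -1 < x \<Longrightarrow> x < 1 \<Longrightarrow> (h has_real_derivative h' x) (at x)"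
      "\<And>x. -1 < x \<Longrightarrow> x < 1 \<Longrightarrow> 0 < h' x"
      "\<And>x. -1 < x \<Longrightarrow> x < 1 \<Longrightarrow> -1 < h x \<and> h x < 1"
      "filterlim h (at_left 1) (at_left 1)" "filterlim h (at_right (-1)) (at_right (-1))"
    and coeff: "\<And>x. -1 < x \<Longrightarrow> x < 1 \<Longrightarrow> flux_coeff \<alpha> (h x) \<le> h' x * flux_coeff \<alpha> x"
      "\<And>x. -1 < x \<Longrightarrow> x < 1 \<Longrightarrow> (l - c\<^sup>2 * x\<^sup>2) * weight \<alpha> x < m * weight \<alpha> (h x) * h' x"
  shows "card (nodes (reg \<alpha> c l)) < card (nodes (reg \<alpha> 0 m))"
proof -
  let ?g = "reg \<alpha> 0 m" and ?g' = "reg' \<alpha> 0 m"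
  define r where "r x = flux_coeff \<alpha> (h x) / h' x" for x
  define s where "s x = m * weight \<alpha> (h x) * h' x" for x
  define v where "v x = ?g (h x)" for x
  define v' where "v' x = ?g' (h x) * h' x" for x
  note g = SL_solution_reg[OF assms(1), of 0 m]
  have zero: "reg \<alpha> c l 0 = 0 \<or> reg' \<alpha> c l 0 = 0" "?g 0 = 0 \<or> ?g' 0 = 0"
    using eigenvalue_iff[OF assms(1)] assms(2,3) by auto
  have flux: "r x * v' x = flux_coeff \<alpha> (h x) * ?g' (h x)" if "-1 < x" "x < 1" for x
    using h(2)[OF that] by (simp add: r_def v'_def)
  have v: "SL_solution r s v v'"
    unfolding SL_solution_def
  proof (intro ballI conjI)
    fix x :: real assume "x \<in> {-1<..<1}"
    then have x: "-1 < x" "x < 1" by auto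
    note hx = h(3)[OF x, THEN conjunct1] h(3)[OF x, THEN conjunct2]
    show "(v has_real_derivative v' x) (at x)"
      unfolding v_def[abs_def] v'_def by (rule DERIV_chain2[OF SL_solutionD(1)[OF g hx] h(1)[OF x]])
    have "((\<lambda>t. flux_coeff \<alpha> (h t) * ?g' (h t)) has_real_derivative
        - mass_coeff \<alpha> 0 m (h x) * ?g (h x) * h' x) (at x)"
      using DERIV_chain2[where f = "\<lambda>y. flux_coeff \<alpha> y * ?g' y" and g = h,
          OF SL_solutionD(2)[OF g hx] h(1)[OF x]] .
    then have "((\<lambda>t. r t * v' t) has_real_derivative - mass_coeff \<alpha> 0 m (h x) * ?g (h x) * h' x) (at x)"
      by (rule has_field_derivative_transform_within_open[of _ _ _ "{-1<..<1}"]) (use x flux in auto)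
    then show "((\<lambda>t. r t * v' t) has_real_derivative - s x * v x) (at x)"
      by (simp add: s_def v_def mass_coeff_def mult_ac)
  qed
  have ends: "regular_end r v v' F"
    if F: "regular_end (flux_coeff \<alpha>) ?g ?g' F" "filterlim h F F"
      "eventually (\<lambda>x. x \<in> {-1<..<1}) F" for F
  proof -
    obtain A where A: "A \<noteq> 0" "(?g \<longlongrightarrow> A) F" "((\<lambda>x. flux_coeff \<alpha> x * ?g' x) \<longlongrightarrow> 0) F"
      using F(1) unfolding regular_end_def by blast
    have "((\<lambda>x. flux_coeff \<alpha> (h x) * ?g' (h x)) \<longlongrightarrow> 0) F"
      using filterlim_compose[OF A(3) F(2)] .
    then have "((\<lambda>x. r x * v' x) \<longlongrightarrow> 0) F"
      by (rule Lim_transform_eventually) (use F(3) flux in \<open>auto elim!: eventually_mono\<close>)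
    moreover have "(v \<longlongrightarrow> A) F"
      unfolding v_def[abs_def] using filterlim_compose[OF A(2) F(2)] .
    ultimately show ?thesis unfolding regular_end_def using A(1) by blast
  qed
  have fin: "finite (nodes (reg \<alpha> c l))" "finite (nodes ?g)"
    by (rule eigenvalue_finite_nodes[OF assms(1,2)], rule eigenvalue_finite_nodes[OF assms(1,3)])
  have inj: "inj_on h (nodes v)"
  proof (rule linorder_inj_onI')
    fix x y assume xy: "x \<in> nodes v" "y \<in> nodes v" "x < y"
    have "h x < h y"
    proof (rule DERIV_pos_imp_increasing[OF xy(3)])
      fix t assume "x \<le> t" "t \<le> y"
      then have t: "-1 < t" "t < 1" using xy by (auto simp: nodes_def)
      show "\<exists>d. (h has_real_derivative d) (at t) \<and> 0 < d"
        using h(1,2)[OF t] by blast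
    qed
    then show "h x \<noteq> h y" by simp
  qed
  have sub: "h ` nodes v \<subseteq> nodes ?g"
    using h(3) by (auto simp: nodes_def v_def)
  have "card (nodes (reg \<alpha> c l)) < card (nodes v)"
  proof (rule sturm_comparison[OF SL_solution_reg[OF assms(1)] v])
    show "0 < r x \<and> r x \<le> flux_coeff \<alpha> x \<and> mass_coeff \<alpha> c l x < s x" if x: "-1 < x" "x < 1" for x
      using coeff[OF x] h(2)[OF x] h(3)[OF x] flux_coeff_pos[of "h x" \<alpha>]
      by (simp add: r_def s_def mass_coeff_def pos_divide_le_eq mult.commute)
    show "regular_end (flux_coeff \<alpha>) (reg \<alpha> c l) (reg' \<alpha> c l) (at_left 1)"
      by (rule regular_end_reg[OF assms(1)])
    show "regular_end (flux_coeff \<alpha>) (reg \<alpha> c l) (reg' \<alpha> c l) (at_right (-1))"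
      by (rule regular_end_reg_left[OF assms(1) zero(1)])
    show "regular_end r v v' (at_left 1)"
      by (rule ends[OF regular_end_reg[OF assms(1)] h(4) eventually_at_left_real]) simp
    show "regular_end r v v' (at_right (-1))"
      by (rule ends[OF regular_end_reg_left[OF assms(1) zero(2)] h(5) eventually_at_right_real]) simp
    show "v' x \<noteq> 0" if x: "-1 < x" "x < 1" "v x = 0" for x
      using reg_simple_zero[OF assms(1), of "h x" 0 m] h(2)[OF x(1,2)] h(3)[OF x(1,2)] x(3)
      by (simp add: v_def v'_def)
    show "finite (nodes v)" using finite_subset[OF sub fin(2)] inj by (rule finite_imageD)
  qed (use fin in auto)
  also have "card (nodes v) \<le> card (nodes ?g)"
    using card_inj_on_le[OF inj sub fin(2)] .
  finally show ?thesis .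
qed

text \<open>
  With \<open>a = 2 \<alpha> + 1\<close> the constant is \<open>(sqrt (1 + a\<^sup>2) - a)\<^sup>2\<close>, which is largest for \<open>a = 1\<close>; the
  value there is \<open>3 - 2 sqrt 2\<close>.
\<close>

lemma C_const_le:
  assumes "0 \<le> \<alpha>"
  shows "C_const \<alpha> \<le> 0.172"
proof -
  define a where "a = 2 * \<alpha> + 1"
  define t where "t = sqrt (1 + a\<^sup>2) - a"
  have a: "1 \<le> a" using assms by (simp add: a_def)
  have sq: "(sqrt (1 + a\<^sup>2))\<^sup>2 = 1 + a\<^sup>2" by (simp add: add_nonneg_nonneg)
  have C: "C_const \<alpha> = t\<^sup>2"
    unfolding C_const_def t_def a_def[symmetric] power2_diff sq by (simp add: algebra_simps)
  have t0: "0 \<le> t" unfolding t_def using real_le_rsqrt[of a "1 + a\<^sup>2"] by simp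
  have "t\<^sup>2 + 2 * a * t = 1"
    using sq by (simp add: t_def power2_eq_square algebra_simps)
  moreover have "2 * 1 * t \<le> 2 * a * t" using a t0 by (intro mult_right_mono) auto
  ultimately have "(t + 1)\<^sup>2 \<le> 2" by (simp add: power2_eq_square algebra_simps)
  also have "\<dots> \<le> (1.4145 :: real)\<^sup>2" by (simp add: power2_eq_square)
  finally have "t + 1 \<le> 1.4145" by (rule power2_le_imp_le) simp
  then have "t\<^sup>2 \<le> 0.4145\<^sup>2" using t0 by (intro power_mono) auto
  then show ?thesis unfolding C by (simp add: power2_eq_square)
qed

text \<open>
  The difference of the two sides is
  \<open>e (2 - 10 C - 12 e X + 28 e X\<^sup>2 - 8 e\<^sup>2 X (1 - X) (1 - 3 X))\<close>. The factor \<open>10\<close> makes the terms of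
  first order in \<open>e\<close> that depend on \<open>X\<close> cancel.
\<close>

lemma transplantation_inequality:
  fixes e X C :: real
  assumes e: "0 \<le> e" "e \<le> 3 / 140" and X: "0 \<le> X" "X \<le> 1" and C: "C \<le> 0.172"
  shows "1 + 10 * e * (C - X) \<le> (1 - 4 * e * X - 4 * e\<^sup>2 * X * (1 - X)) * (1 + 2 * e - 6 * e * X)"
proof -
  have "X * (1 - X) * (1 - 3 * X) \<le> X * (1 - X) * 1"
    using X by (intro mult_left_mono) auto
  also have "\<dots> \<le> 1" using X mult_le_one[of X "1 - X"] by simp
  finally have "8 * e\<^sup>2 * (X * (1 - X) * (1 - 3 * X)) \<le> 8 * e\<^sup>2 * 1"
    by (intro mult_left_mono) auto
  moreover have "e\<^sup>2 \<le> (3 / 140)\<^sup>2" using e by (intro power_mono) auto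
  moreover have "e * X \<le> 3 / 140 * 1" using e X by (intro mult_mono) auto
  moreover have "0 \<le> e * X\<^sup>2" using e by simp
  ultimately have "0 \<le> 2 - 10 * C - 12 * (e * X) + 28 * (e * X\<^sup>2) - 8 * e\<^sup>2 * (X * (1 - X) * (1 - 3 * X))"
    using C by (simp add: power2_eq_square)
  then have "0 \<le> e * (2 - 10 * C - 12 * (e * X) + 28 * (e * X\<^sup>2) - 8 * e\<^sup>2 * (X * (1 - X) * (1 - 3 * X)))"
    using e by simp
  then show ?thesis by (simp add: power2_eq_square algebra_simps)
qed

text \<open>
  Here \<open>1 - h\<^sup>2 = (1 - x\<^sup>2) R\<close> with a polynomial \<open>R\<close> that satisfies \<open>0 < R \<le> 1\<close> and \<open>R \<le> h'\<close>. The
  transplanted coefficients therefore are \<open>p R powr (\<alpha> + 1) / h' \<le> p\<close> and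
  \<open>\<lambda> \<omega> R powr \<alpha> h' \<ge> \<lambda> \<omega> R h'\<close>, where \<open>\<alpha> \<le> 1\<close> is used. The product \<open>R h'\<close> is estimated in
  \<open>transplantation_inequality\<close> with \<open>X = x\<^sup>2\<close>.
\<close>

theorem chi_lower_bound:
  assumes "0 \<le> \<alpha>" "\<alpha> \<le> 1" and small: "14 * c\<^sup>2 \<le> 3 * gegenbauer_eigenvalue \<alpha> n" and c: "c \<noteq> 0"
  shows "gegenbauer_eigenvalue \<alpha> n + C_const \<alpha> * c\<^sup>2 \<le> chi \<alpha> c n"
proof (rule ccontr)
  let ?l = "gegenbauer_eigenvalue \<alpha> n" and ?C = "C_const \<alpha>"
  assume "\<not> ?thesis"
  then have less: "chi \<alpha> c n < ?l + ?C * c\<^sup>2" by simp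
  have "0 < c\<^sup>2" using c by simp
  then have l: "0 < ?l" using small by linarith
  define e where "e = c\<^sup>2 / (10 * ?l)"
  have ce: "c\<^sup>2 = 10 * e * ?l" using l by (simp add: e_def)
  have e: "0 \<le> e" "e \<le> 3 / 140" using l small by (auto simp: e_def field_simps)
  define h where "h x = x * (1 + 2 * e * (1 - x\<^sup>2))" for x
  define h' where "h' x = 1 + 2 * e - 6 * e * x\<^sup>2" for x
  define R where "R x = 1 - 4 * e * x\<^sup>2 - 4 * e\<^sup>2 * x\<^sup>2 * (1 - x\<^sup>2)" for x
  have square: "1 - (h x)\<^sup>2 = (1 - x\<^sup>2) * R x" for x
    by (simp add: h_def R_def power2_eq_square algebra_simps)
  have dh: "(h has_real_derivative h' x) (at x)" for x
    unfolding h_def[abs_def] h'_def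
    by (auto intro!: derivative_eq_intros simp: power2_eq_square algebra_simps)
  have R: "0 < R x" "R x \<le> 1" "R x \<le> h' x" "0 < h' x" if "-1 < x" "x < 1" for x
  proof -
    have X: "0 \<le> x\<^sup>2" "x\<^sup>2 \<le> 1" using one_minus_square_pos[OF that] by auto
    have 1: "e * x\<^sup>2 \<le> e" "0 \<le> e * x\<^sup>2" using e X by (auto intro: mult_left_le)
    have "e\<^sup>2 * x\<^sup>2 * (1 - x\<^sup>2) \<le> (3 / 140)\<^sup>2 * 1 * 1"
      using e X by (intro mult_mono power_mono) auto
    moreover have "0 \<le> e\<^sup>2 * x\<^sup>2 * (1 - x\<^sup>2)" using X by simp
    moreover have "R x = 1 - 4 * (e * x\<^sup>2) - 4 * (e\<^sup>2 * x\<^sup>2 * (1 - x\<^sup>2))"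
      "h' x = 1 + 2 * e - 6 * (e * x\<^sup>2)"
      by (simp_all add: R_def h'_def)
    moreover have "(3 / 140)\<^sup>2 * 1 * 1 \<le> (1 / 100 :: real)" by (simp add: power2_eq_square)
    ultimately show "0 < R x" "R x \<le> 1" "R x \<le> h' x" "0 < h' x"
      using 1 e by linarith+
  qed
  have h_in: "-1 < h x \<and> h x < 1" if "-1 < x" "x < 1" for x
  proof -
    have "0 < 1 - (h x)\<^sup>2"
      unfolding square using R(1)[OF that] one_minus_square_pos[OF that] by simp
    then show ?thesis by (simp add: abs_square_less_1 abs_less_iff)
  qed
  have weight_h: "weight \<alpha> (h x) = weight \<alpha> x * R x powr \<alpha>" if "-1 < x" "x < 1" for x
    unfolding weight_def square using R(1)[OF that] one_minus_square_pos[OF that]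
    by (simp add: powr_mult)
  have lim: "(h \<longlongrightarrow> h x) (at x within S)" for x S
    using DERIV_isCont[OF dh[of x]] by (auto simp: isCont_def intro: tendsto_within_subset)
  have "card (nodes (reg \<alpha> c (chi \<alpha> c n))) < card (nodes (reg \<alpha> 0 ?l))"
  proof (rule nodes_less_transplanted[OF assms(1) chi_nodes(1)[OF assms(1)] gegenbauer_eigenvalue_in[OF assms(1)],
        where h = h and h' = h'])
    have "eventually (\<lambda>x. h x \<in> {..<1} \<and> h x \<noteq> 1) (at_left 1)"
      by (rule eventually_mono[OF eventually_at_left_real[of "-1" 1]]) (use h_in in force)+
    moreover have "h 1 = 1" by (simp add: h_def)
    ultimately show "filterlim h (at_left 1) (at_left 1)"
      unfolding filterlim_at using lim[of 1 "{..<1}"] by simp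
    have "eventually (\<lambda>x. h x \<in> {-1<..} \<and> h x \<noteq> -1) (at_right (-1))"
      by (rule eventually_mono[OF eventually_at_right_real[of "-1" 1]]) (use h_in in force)+
    moreover have "h (-1) = -1" by (simp add: h_def)
    ultimately show "filterlim h (at_right (-1)) (at_right (-1))"
      unfolding filterlim_at using lim[of "-1" "{-1<..}"] by simp
    fix x :: real assume x: "-1 < x" "x < 1"
    show "(h has_real_derivative h' x) (at x)" "0 < h' x" "-1 < h x \<and> h x < 1"
      by (fact dh R(4)[OF x] h_in[OF x])+
    note Rx = R[OF x] and w = weight_pos[OF x, of \<alpha>]
    have "R x powr \<alpha> \<le> 1" using powr_mono2[OF assms(1), of "R x" 1] Rx by simp
    then have "R x powr \<alpha> * R x \<le> 1 * h' x"
      using Rx by (intro mult_mono) auto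
    then have "flux_coeff \<alpha> x * (R x powr \<alpha> * R x) \<le> flux_coeff \<alpha> x * (1 * h' x)"
      using flux_coeff_pos[OF x, of \<alpha>] by (intro mult_left_mono) auto
    then show "flux_coeff \<alpha> (h x) \<le> h' x * flux_coeff \<alpha> x"
      by (simp add: flux_coeff_def weight_h[OF x] square mult_ac)
    have "R x powr 1 \<le> R x powr \<alpha>"
      using Rx assms by (intro powr_mono') auto
    then have R_le: "R x * h' x \<le> R x powr \<alpha> * h' x"
      using Rx by (intro mult_right_mono) auto
    have "chi \<alpha> c n - c\<^sup>2 * x\<^sup>2 < ?l + ?C * c\<^sup>2 - c\<^sup>2 * x\<^sup>2" using less by simp
    also have "\<dots> = ?l * (1 + 10 * e * (?C - x\<^sup>2))"
      unfolding ce by (simp add: algebra_simps)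
    also have "\<dots> \<le> ?l * (R x * h' x)"
      unfolding R_def h'_def using l one_minus_square_pos[OF x]
      by (intro mult_left_mono transplantation_inequality e C_const_le assms(1)) auto
    also have "\<dots> \<le> ?l * (R x powr \<alpha> * h' x)"
      using R_le l by (intro mult_left_mono) auto
    finally have "(chi \<alpha> c n - c\<^sup>2 * x\<^sup>2) * weight \<alpha> x < ?l * (R x powr \<alpha> * h' x) * weight \<alpha> x"
      using w by simp
    then show "(chi \<alpha> c n - c\<^sup>2 * x\<^sup>2) * weight \<alpha> x < ?l * weight \<alpha> (h x) * h' x"
      by (simp add: weight_h[OF x] mult_ac)
  qed
  then show False
    using chi_nodes(2)[OF assms(1)] card_nodes_gegenbauer[OF assms(1)] by simp
qed

theorem proposition1:
  fixes \<alpha> c q :: real and n :: nat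
  assumes "0 \<le> \<alpha>" and "\<alpha> \<le> 1 / 4"
    and "c > 0"
    and "q = c\<^sup>2 / chi \<alpha> c n"
    and "0 < q" and "q < 3 / 17"
  shows "real n * (real n + 2 * \<alpha> + 1) + C_const \<alpha> * c\<^sup>2 \<le> chi \<alpha> c n
       \<and> chi \<alpha> c n \<le> real n * (real n + 2 * \<alpha> + 1) + c\<^sup>2"
proof -
  note upper = chi_upper_bound[OF assms(1), of c n]
  have "0 < c\<^sup>2" using assms(3) by simp
  moreover have "0 < c\<^sup>2 / chi \<alpha> c n" using assms(4,5) by simp
  ultimately have "0 < chi \<alpha> c n" by (simp add: zero_less_divide_iff)
  moreover from this have "c\<^sup>2 = q * chi \<alpha> c n" using assms(4) by simp
  ultimately have "c\<^sup>2 < 3 / 17 * chi \<alpha> c n"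
    using assms(6) by (simp only: mult_strict_right_mono)
  \<comment> \<open>From \<open>c\<^sup>2 < 3 / 17 \<chi>\<close> and \<open>\<chi> \<le> \<lambda> + c\<^sup>2\<close>; this makes \<open>e \<le> 3 / 140\<close>.\<close>
  then have "14 * c\<^sup>2 \<le> 3 * gegenbauer_eigenvalue \<alpha> n" using upper by simp
  from chi_lower_bound[OF assms(1) _ this] upper assms(2,3) show ?thesis
    by (simp add: gegenbauer_eigenvalue_def)
qed

end
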